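(* Let $a_1\ne a_2$ be non-negative integers, $\Omega=[a_1,a_1+1)\cup[a_2,a_2+1)$, and let $\mathbf N=(N,N)$ be simple for $\Omega$. Let $T:\Omega\to\Omega$ be the associated map, $\mathcal B_\Omega$ the Borel $\sigma$-algebra of $\Omega$, and $\mu_T$ the unique $T$-invariant ergodic Borel probability measure on $\Omega$ that is absolutely continuous with respect to Lebesgue measure. Define $$X=\big([a_1,a_1+1)\times[a_2,a_2+1]\big)\cup\big([a_2,a_2+1)\times[a_1,a_1+1]\big),$$ let $\mathcal B_X$ be the Borel $\sigma$-algebra of $X$, and define (up to Lebesgue null sets) $\overline{\mathcal T_T}:X\to X$ by $$\overline{\mathcal T_T}(x,y)=\left(T(x),\frac{N}{d_1(x)+y}\right).$$ Then the natural extension of $(T,\Omega,\mu_T,\mathcal B_\Omega)$ is given by $(\overline{\mathcal T_T},X,\overline{\mu_T},\mathcal B_X)$, where the invariant measure $\overline{\mu_T}$ is given by $$\overline{\mu_T}(A)=C\iint_A\frac{N}{(N+xy)^2}\,dy\,dx\qquad(A\in\mathcal B_X),$$ with $$C^{-1}=\iint_X\frac{N}{(N+xy)^2}\,dy\,dx=2\ln\left[1+\frac{N}{(N+a_1(a_2+1))(N+a_2(a_1+1))}\right].$$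
   Context: Write $I_1=[a_1,a_1+1)$, $I_2=[a_2,a_2+1)$. The pair $\mathbf N=(N,N)$, with $N$ a positive integer, is simple for $\Omega$ if (i) it is allowable: $\lfloor N/x\rfloor-a_2>0$ for all $x\in I_1$, $x\ne0$, and $\lfloor N/x\rfloor-a_1>0$ for all $x\in I_2$, $x\neq0$; and (ii) for each $i\in\{1,2\}$ with $a_i\ne0$, both $a_i\mid N$ and $a_i+1\mid N$. The map $T$ is $$T(x)=\frac Nx-\left\lfloor\frac Nx\right\rfloor+a_2\ (x\in I_1,\ x\ne0),\qquad T(x)=\frac Nx-\left\lfloor\frac Nx\right\rfloor+a_1\ (x\in I_2,\ x\neq0),$$ and $T(0)=0$ if $0\in\Omega$. The first digit is $d_1(x)=\lfloor N/x\rfloor-a_2$ for $x\in I_1\setminus\{0\}$ and $d_1(x)=\lfloor N/x\rfloor-a_1$ for $x\in I_2\setminus\{0\}$, so $T(x)=N/x-d_1(x)$. Natural extension: a measure-preserving system $(S,X,\nu,\mathcal B_X)$ is the natural extension of $(T,\Omega,\mu,\mathcal B_\Omega)$ if $S$ is invertible $\nu$-almost everywhere (bimeasurably, mod null sets), there is a factor map $\pi:X\to\Omega$ (here the projection onto the first coordinate) with $\pi\circ S=T\circ\pi$ a.e. and $\pi_*\nu=\mu$, and $\mathcal B_X=\bigvee_{i\ge0}S^i(\pi^{-1}\mathcal B_\Omega)$ modulo $\nu$-null sets. *)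

theory Defs
  imports "HOL-Probability.Probability"
begin

section \<open>Measure-preserving systems and natural extensions\<close>

definition measure_preserving_system :: "'a measure \<Rightarrow> ('a \<Rightarrow> 'a) \<Rightarrow> bool" where
  "measure_preserving_system M T \<longleftrightarrow>
     prob_space M \<and> T \<in> measurable M M \<and> distr M M T = M"

definition ergodic_system :: "'a measure \<Rightarrow> ('a \<Rightarrow> 'a) \<Rightarrow> bool" where
  "ergodic_system M T \<longleftrightarrow>
     measure_preserving_system M T \<and>
     (\<forall>A\<in>sets M. T -` A \<inter> space M = A \<longrightarrow> emeasure M A = 0 \<or> emeasure M (space M - A) = 0)"

text \<open>
  The map \<open>S\<close> is only relevant up to null sets: it may leave \<open>space M\<close> on a null set. The set
  \<open>Y\<close> is a set of full measure on which \<open>S\<close> is an honest bimeasurable, measure-preserving bijection.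
\<close>
definition invertible_system_on :: "'a set \<Rightarrow> 'a measure \<Rightarrow> ('a \<Rightarrow> 'a) \<Rightarrow> bool" where
  "invertible_system_on Y M S \<longleftrightarrow>
     prob_space M \<and>
     Y \<in> sets M \<and> emeasure M (space M - Y) = 0 \<and>
     bij_betw S Y Y \<and>
     S \<in> measurable (restrict_space M Y) (restrict_space M Y) \<and>
     inv_into Y S \<in> measurable (restrict_space M Y) (restrict_space M Y) \<and>
     distr (restrict_space M Y) (restrict_space M Y) S = restrict_space M Y"

text \<open>The join of the \<open>\<sigma>\<close>-algebras \<open>S\<^sup>i (p\<^sup>-\<^sup>1 (sets M))\<close>, \<open>i \<ge> 0\<close>, as a family of subsets of \<open>Y\<close>.\<close>
definition forward_join ::
    "'b set \<Rightarrow> ('b \<Rightarrow> 'b) \<Rightarrow> ('b \<Rightarrow> 'a) \<Rightarrow> 'a measure \<Rightarrow> 'b set set" where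
  "forward_join Y S p M =
     sigma_sets Y (\<Union>i::nat. {(S ^^ i) ` (p -` B \<inter> Y) | B. B \<in> sets M})"

definition equal_mod_null :: "'a measure \<Rightarrow> 'a set set \<Rightarrow> 'a set set \<Rightarrow> bool" where
  "equal_mod_null M \<A> \<B> \<longleftrightarrow>
     (\<forall>A\<in>\<A>. \<exists>B\<in>\<B>. (A - B) \<union> (B - A) \<in> null_sets M) \<and>
     (\<forall>B\<in>\<B>. \<exists>A\<in>\<A>. (A - B) \<union> (B - A) \<in> null_sets M)"

text \<open>\<open>(S, \<nu>)\<close> is the natural extension of \<open>(T, \<mu>)\<close> via the factor map \<open>p\<close>.\<close>
definition natural_extension ::
    "('b \<Rightarrow> 'a) \<Rightarrow> 'b measure \<Rightarrow> ('b \<Rightarrow> 'b) \<Rightarrow> 'a measure \<Rightarrow> ('a \<Rightarrow> 'a) \<Rightarrow> bool" where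
  "natural_extension p \<nu> S \<mu> T \<longleftrightarrow>
     measure_preserving_system \<mu> T \<and>
     p \<in> measurable \<nu> \<mu> \<and> (AE z in \<nu>. p (S z) = T (p z)) \<and> distr \<nu> \<mu> p = \<mu> \<and>
     (\<exists>Y. invertible_system_on Y \<nu> S \<and> equal_mod_null \<nu> (sets \<nu>) (forward_join Y S p \<mu>))"


section \<open>The continued fraction map on two unit intervals\<close>

definition unit_ival :: "nat \<Rightarrow> real set" where
  "unit_ival a = {real a ..< real a + 1}"

definition Omega :: "nat \<Rightarrow> nat \<Rightarrow> real set" where
  "Omega a1 a2 = unit_ival a1 \<union> unit_ival a2"

definition allowable :: "nat \<Rightarrow> nat \<Rightarrow> nat \<Rightarrow> bool" where
  "allowable a1 a2 N \<longleftrightarrow>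
     (\<forall>x\<in>unit_ival a1. x \<noteq> 0 \<longrightarrow> \<lfloor>real N / x\<rfloor> - int a2 > 0) \<and>
     (\<forall>x\<in>unit_ival a2. x \<noteq> 0 \<longrightarrow> \<lfloor>real N / x\<rfloor> - int a1 > 0)"

definition simple_pair :: "nat \<Rightarrow> nat \<Rightarrow> nat \<Rightarrow> bool" where
  "simple_pair a1 a2 N \<longleftrightarrow>
     N > 0 \<and> allowable a1 a2 N \<and>
     (\<forall>a\<in>{a1, a2}. a \<noteq> 0 \<longrightarrow> a dvd N \<and> (a + 1) dvd N)"

text \<open>The values of the digit at \<open>0\<close> and of both functions outside \<open>Omega a1 a2\<close> are dummies.\<close>
definition digit1 :: "nat \<Rightarrow> nat \<Rightarrow> nat \<Rightarrow> real \<Rightarrow> int" where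
  "digit1 a1 a2 N x =
     (if x \<noteq> 0 \<and> x \<in> unit_ival a1 then \<lfloor>real N / x\<rfloor> - int a2
      else if x \<noteq> 0 \<and> x \<in> unit_ival a2 then \<lfloor>real N / x\<rfloor> - int a1
      else 0)"

definition cf_map :: "nat \<Rightarrow> nat \<Rightarrow> nat \<Rightarrow> real \<Rightarrow> real" where
  "cf_map a1 a2 N x =
     (if x \<noteq> 0 \<and> x \<in> unit_ival a1 then real N / x - of_int \<lfloor>real N / x\<rfloor> + real a2
      else if x \<noteq> 0 \<and> x \<in> unit_ival a2 then real N / x - of_int \<lfloor>real N / x\<rfloor> + real a1
      else 0)"

definition ergodic_acim :: "nat \<Rightarrow> nat \<Rightarrow> nat \<Rightarrow> real measure \<Rightarrow> bool" where
  "ergodic_acim a1 a2 N \<mu> \<longleftrightarrow>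
     sets \<mu> = sets (restrict_space borel (Omega a1 a2)) \<and>
     ergodic_system \<mu> (cf_map a1 a2 N) \<and>
     absolutely_continuous (restrict_space lborel (Omega a1 a2)) \<mu>"

definition mu_T :: "nat \<Rightarrow> nat \<Rightarrow> nat \<Rightarrow> real measure" where
  "mu_T a1 a2 N = (THE \<mu>. ergodic_acim a1 a2 N \<mu>)"


section \<open>The planar map and its measure\<close>

definition ext_dom :: "nat \<Rightarrow> nat \<Rightarrow> (real \<times> real) set" where
  "ext_dom a1 a2 =
     {real a1 ..< real a1 + 1} \<times> {real a2 .. real a2 + 1} \<union>
     {real a2 ..< real a2 + 1} \<times> {real a1 .. real a1 + 1}"

definition ext_map :: "nat \<Rightarrow> nat \<Rightarrow> nat \<Rightarrow> real \<times> real \<Rightarrow> real \<times> real" where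
  "ext_map a1 a2 N = (\<lambda>(x, y). (cf_map a1 a2 N x, real N / (of_int (digit1 a1 a2 N x) + y)))"

definition ext_kernel :: "nat \<Rightarrow> real \<times> real \<Rightarrow> real" where
  "ext_kernel N = (\<lambda>(x, y). real N / (real N + x * y)\<^sup>2)"

definition norm_const :: "nat \<Rightarrow> nat \<Rightarrow> nat \<Rightarrow> real" where
  "norm_const a1 a2 N = inverse (set_lebesgue_integral lborel (ext_dom a1 a2) (ext_kernel N))"

definition ext_measure :: "nat \<Rightarrow> nat \<Rightarrow> nat \<Rightarrow> (real \<times> real) measure" where
  "ext_measure a1 a2 N =
     density (restrict_space lborel (ext_dom a1 a2))
       (\<lambda>z. ennreal (norm_const a1 a2 N * ext_kernel N z))"

end

theory Submission
  imports Defs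
begin

text \<open>
  Both maps are studied off the rationals. There the branch of \<open>T\<close> with digit \<open>d\<close> on one unit
  interval maps onto the other interval with inverse \<open>y \<mapsto> N / (d + y)\<close>; surjectivity is what the
  divisibility conditions provide. Hence swapping the coordinates conjugates the planar map \<open>S\<close> to
  its inverse, and Tonelli together with the substitution \<open>x = N / (d + y)\<close>, applied once in
  each coordinate, shows that \<open>S\<close> preserves the kernel \<open>N / (N + x y)\<^sup>2\<close>. The first marginal of
  that measure is the invariant measure of \<open>T\<close>.

  Points with the same first \<open>2 n\<close> digits have distance at most \<open>\<theta>\<^sup>2\<^sup>n\<close>, because on a branch
  \<open>\<bar>x - x'\<bar> N = \<bar>T x - T x'\<bar> x x'\<close> and \<open>x (T x) \<le> \<theta> N\<close> with \<open>\<theta> < 1\<close>. So open sets are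
  increasing unions of countable unions of cylinders. Inverse branches of the iterates are Moebius
  maps with derivative \<open>K / (c y + d)\<^sup>2\<close>, where \<open>0 \<le> c \<le> d\<close>, and therefore have distortion at
  most \<open>4\<close>: an invariant set of positive measure meets every cylinder in a fixed proportion, hence
  has full measure. As the invariant measure is equivalent to Lebesgue measure, ergodicity gives
  uniqueness through the superlevel set \<open>{f > 1}\<close> of a density. Finally, the digits of \<open>y\<close>
  are first digits along the backward orbit of \<open>(x, y)\<close>, so the images \<open>S\<^sup>i (fst\<^sup>-\<^sup>1 B)\<close>
  generate the Borel sets.
\<close>

section \<open>Branches of the map\<close>

locale simple_cf =
  fixes a1 a2 N :: nat
  assumes distinct: "a1 \<noteq> a2" and simple: "simple_pair a1 a2 N"
begin

abbreviation T :: "real \<Rightarrow> real" where "T \<equiv> cf_map a1 a2 N"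
abbreviation dg :: "real \<Rightarrow> int" where "dg \<equiv> digit1 a1 a2 N"
abbreviation S :: "real \<times> real \<Rightarrow> real \<times> real" where "S \<equiv> ext_map a1 a2 N"

text \<open>Lets every branch statement be proved once for both intervals: \<open>T\<close> carries
  the interval at \<open>a\<close> into the one at \<open>b\<close>.\<close>

definition adj :: "nat \<Rightarrow> nat \<Rightarrow> bool" where
  "adj a b \<longleftrightarrow> a = a1 \<and> b = a2 \<or> a = a2 \<and> b = a1"

text \<open>Dropping the rationals discards \<open>0\<close>, the endpoints and every point where
  \<open>N / x\<close> is an integer. \<open>T\<close> respects this, since an irrational number
  minus an integer stays irrational.\<close>

definition Z :: "nat \<Rightarrow> real set" where
  "Z a = unit_ival a - \<rat>"

lemma adj_sym: "adj a b \<Longrightarrow> adj b a"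
  by (auto simp: adj_def)

lemma N_pos: "real N > 0"
  using simple by (simp add: simple_pair_def)

text \<open>The second divisibility covers \<open>a = 0\<close> too, because \<open>1\<close>
  divides \<open>N\<close>; right endpoints then need no case distinction.\<close>

lemma adj_dvd:
  assumes "adj a b"
  shows "a \<noteq> 0 \<Longrightarrow> a dvd N" "(a + 1) dvd N"
  using assms simple by (cases "a = 0"; auto simp: adj_def simple_pair_def)+

lemma unit_ival_disjoint:
  assumes "adj a b" "x \<in> unit_ival a"
  shows "x \<notin> unit_ival b"
  using assms distinct by (auto simp: adj_def unit_ival_def)

lemma digit_eq:
  assumes "adj a b" "x \<in> unit_ival a" "x \<noteq> 0"
  shows "dg x = \<lfloor>real N / x\<rfloor> - int b"
  using assms unit_ival_disjoint[OF assms(1,2)] by (auto simp: adj_def digit1_def)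

lemma T_eq_floor:
  assumes "adj a b" "x \<in> unit_ival a" "x \<noteq> 0"
  shows "T x = real N / x - of_int \<lfloor>real N / x\<rfloor> + real b"
  using assms unit_ival_disjoint[OF assms(1,2)] by (auto simp: adj_def cf_map_def)

lemma T_eq:
  assumes "adj a b" "x \<in> unit_ival a" "x \<noteq> 0"
  shows "T x = real N / x - of_int (dg x)"
  using digit_eq[OF assms] T_eq_floor[OF assms] by simp

lemma digit_pos:
  assumes "adj a b" "x \<in> unit_ival a" "x \<noteq> 0"
  shows "dg x \<ge> 1"
  using digit_eq[OF assms] assms simple by (auto simp: adj_def simple_pair_def allowable_def)

lemma T_in:
  assumes "adj a b" "x \<in> unit_ival a" "x \<noteq> 0"
  shows "T x \<in> unit_ival b"
  unfolding T_eq_floor[OF assms] unit_ival_def by (auto, linarith+)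

lemma Z_D: "x \<in> Z a \<Longrightarrow> x \<in> unit_ival a" "x \<in> Z a \<Longrightarrow> x \<notin> \<rat>" "x \<in> Z a \<Longrightarrow> x \<noteq> 0"
    "x \<in> Z a \<Longrightarrow> x > real a" "x \<in> Z a \<Longrightarrow> x < real a + 1" "x \<in> Z a \<Longrightarrow> x > 0"
proof -
  show "x \<in> Z a \<Longrightarrow> x \<noteq> 0" by (auto simp: Z_def)
  show "x > real a" if "x \<in> Z a"
  proof -
    have "x \<noteq> real a" using that by (auto simp: Z_def)
    then show ?thesis using that by (auto simp: Z_def unit_ival_def)
  qed
  then show "x \<in> Z a \<Longrightarrow> x > 0" using of_nat_0_le_iff[of a, where ?'a=real] by force
qed (auto simp: Z_def unit_ival_def)

lemma Rats_div_iff: "x \<noteq> 0 \<Longrightarrow> real N / x \<in> \<rat> \<longleftrightarrow> x \<in> \<rat>"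
proof
  assume "x \<noteq> 0" "real N / x \<in> \<rat>"
  then have "real N / (real N / x) \<in> \<rat>" by (metis Rats_divide Rats_of_nat)
  moreover have "real N / (real N / x) = x" using N_pos \<open>x \<noteq> 0\<close> by (simp add: field_simps)
  ultimately show "x \<in> \<rat>" by simp
qed auto

lemma Rats_add_int_iff: "of_int d + x \<in> \<rat> \<longleftrightarrow> (x::real) \<in> \<rat>"
  by (metis Rats_add Rats_diff Rats_of_int add_diff_cancel_left')

lemma T_Z:
  assumes "adj a b" "x \<in> Z a"
  shows "T x \<in> Z b" "real N / (of_int (dg x) + T x) = x"
proof -
  note z = Z_D(1,2,3)[OF assms(2)]
  have "T x \<notin> \<rat>"
    using T_eq[OF assms(1) z(1,3)] Rats_div_iff[OF z(3)] z(2) Rats_add_int_iff[of "dg x" "T x"] by simp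
  then show "T x \<in> Z b" using T_in[OF assms(1) z(1,3)] by (simp add: Z_def)
  show "real N / (of_int (dg x) + T x) = x"
    using T_eq[OF assms(1) z(1,3)] N_pos by simp
qed

text \<open>All branches are full. If \<open>k\<close> is the floor of \<open>N / x\<close>, then
  \<open>d + y\<close> lies strictly between \<open>k\<close> and \<open>k + 1\<close>. As
  \<open>N / (a + 1)\<close> and, for nonzero \<open>a\<close>, \<open>N / a\<close> are integers,
  the gap from \<open>k\<close> to \<open>k + 1\<close> lies between them once it contains
  \<open>N / x\<close>; hence \<open>N / (d + y)\<close> falls into the interval at
  \<open>a\<close>.\<close>

lemma inverse_branch:
  assumes adj: "adj a b" and x: "x \<in> Z a" and y: "y \<in> Z b"
  defines "v \<equiv> real N / (of_int (dg x) + y)"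
  shows "v \<in> Z a" "dg v = dg x" "T v = y"
proof -
  note zx = Z_D[OF x] and zy = Z_D[OF y]
  define k where "k = \<lfloor>real N / x\<rfloor>"
  have dk: "dg x = k - int b" unfolding k_def by (rule digit_eq[OF adj zx(1,3)])
  have w: "of_int (dg x) + y > of_int k" "of_int (dg x) + y < of_int k + 1"
    using dk zy by auto
  have d1: "dg x \<ge> 1" by (rule digit_pos[OF adj zx(1,3)])
  then have wpos: "of_int (dg x) + y > 0" using zy by (smt (verit) of_int_1_le_iff)
  have vpos: "v > 0" using wpos N_pos by (simp add: v_def)
  have Nv: "real N / v = of_int (dg x) + y" using N_pos wpos by (simp add: v_def)
  have vnr: "v \<notin> \<rat>" using Rats_div_iff[of v] vpos Nv zy(2) Rats_add_int_iff[of "dg x" y] by simp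
  have up: "v < real a + 1"
  proof -
    obtain m where m: "N = (a + 1) * m" using adj_dvd(2)[OF adj] by blast
    have "real m * x \<le> real m * (real a + 1)" using zx(5) by (intro mult_left_mono) auto
    also have "\<dots> = real N" by (simp add: m algebra_simps)
    finally have "real m \<le> real N / x" using zx by (simp add: field_simps)
    then have "int m \<le> k" unfolding k_def by linarith
    then have "real m < of_int (dg x) + y" using w by linarith
    then have "(real a + 1) * real m < (real a + 1) * (of_int (dg x) + y)"
      by (intro mult_strict_left_mono) auto
    moreover have "(real a + 1) * real m = real N" by (simp add: m algebra_simps)
    ultimately show ?thesis using wpos by (simp add: v_def field_simps)
  qed
  \<comment> \<open>For \<open>a = 0\<close> positivity is enough. Otherwise the integer
    \<open>m = N / a\<close> exceeds \<open>N / x\<close>, which forces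
    \<open>k + 1 \<le> m\<close>.\<close>
  have lo: "v \<ge> real a"
  proof (cases "a = 0")
    case True then show ?thesis using vpos by simp
  next
    case False
    obtain m where m: "N = a * m" using adj_dvd(1)[OF adj False] by blast
    have "m > 0" using m N_pos by (cases m) auto
    then have "real a * real m < x * real m" using zx by (intro mult_strict_right_mono) auto
    then have "real N / x < real m" using zx by (simp add: m field_simps)
    then have "k < int m" unfolding k_def by linarith
    then have "of_int (dg x) + y \<le> real m" using w by linarith
    then have "real a * (of_int (dg x) + y) \<le> real a * real m" by (intro mult_left_mono) auto
    then show ?thesis using wpos by (simp add: v_def m field_simps)
  qed
  show vZ: "v \<in> Z a" using lo up vnr by (simp add: Z_def unit_ival_def)
  have "\<lfloor>real N / v\<rfloor> = k" unfolding Nv using w by linarith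
  then show dv: "dg v = dg x" using digit_eq[OF adj Z_D(1,3)[OF vZ]] dk by simp
  show "T v = y" using T_eq[OF adj Z_D(1,3)[OF vZ]] dv Nv by simp
qed

section \<open>Measurability and the reciprocal substitution\<close>

lemma T_measurable [measurable]: "T \<in> borel_measurable borel"
  unfolding cf_map_def unit_ival_def by measurable

lemma digit_measurable [measurable]: "dg \<in> measurable borel (count_space UNIV)"
  unfolding digit1_def unit_ival_def by measurable

lemma S_measurable [measurable]: "S \<in> borel_measurable borel"
  unfolding ext_map_def borel_prod[symmetric] by measurable

lemma Rats_borel [measurable]: "(\<rat> :: real set) \<in> sets borel"
  by (rule sets.countable) (auto simp: countable_rat)

lemma unit_ival_borel [measurable]: "unit_ival a \<in> sets borel"
  unfolding unit_ival_def by measurable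

lemma Z_borel [measurable]: "Z a \<in> sets borel"
  unfolding Z_def by measurable

text \<open>The map \<open>y \<mapsto> c / y\<close> is decreasing. Reflecting \<open>x\<close>
  first turns it into the increasing map \<open>y \<mapsto> - c / y\<close>, whose derivative is the
  weight.\<close>

lemma nn_integral_reciprocal_subst:
  fixes f :: "real \<Rightarrow> ennreal" and c p q :: real
  assumes [measurable]: "f \<in> borel_measurable borel" and c: "c > 0" and p: "p > 0" and "p < q"
  shows "(\<integral>\<^sup>+x. f x * indicator {c / q..c / p} x \<partial>lborel)
    = (\<integral>\<^sup>+y. f (c / y) * ennreal (c / y\<^sup>2) * indicator {p..q} y \<partial>lborel)"
proof -
  have "(\<integral>\<^sup>+x. f x * indicator {c / q..c / p} x \<partial>lborel)
      = (\<integral>\<^sup>+x. f (- x) * indicator {- c / p..- c / q} x \<partial>lborel)"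
    by (subst nn_integral_real_affine[of _ "-1" 0]) (auto intro!: nn_integral_cong simp: indicator_def)
  also have "\<dots> = (\<integral>\<^sup>+y. f (- (- c / y)) * ennreal (c / y\<^sup>2) * indicator {p..q} y \<partial>lborel)"
  proof (rule nn_integral_substitution_aux[where g = "\<lambda>y. - c / y"])
    show "((\<lambda>y. - c / y) has_real_derivative c / x\<^sup>2) (at x)" if "x \<in> {p..q}" for x
      using that p by (auto intro!: derivative_eq_intros simp: power2_eq_square)
    show "continuous_on {p..q} (\<lambda>x. c / x\<^sup>2)"
      using p by (auto intro!: continuous_intros)
  qed (use c p \<open>p < q\<close> in auto)
  finally show ?thesis by simp
qed

section \<open>Invariance of the planar kernel\<close>

lemma AE_not_Rats: "AE x in lborel. x \<notin> (\<rat> :: real set)"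
  by (rule AE_I'[of "\<rat>"]) (auto simp: emeasure_lborel_countable[OF countable_rat] null_sets_def)

text \<open>Up to rationals the points with a given digit \<open>d\<close> form a closed interval,
  so the reciprocal substitution applies; a translation by \<open>d\<close> then brings the new
  variable to the interval at \<open>b\<close>.\<close>

lemma nn_integral_branch:
  fixes f :: "real \<Rightarrow> ennreal"
  assumes adj: "adj a b" and x0: "x0 \<in> Z a" and [measurable]: "f \<in> borel_measurable borel"
  shows "(\<integral>\<^sup>+x. f x * indicator {x \<in> Z a. dg x = dg x0} x \<partial>lborel)
    = (\<integral>\<^sup>+y. f (real N / (of_int (dg x0) + y)) * ennreal (real N / (of_int (dg x0) + y)\<^sup>2)
        * indicator (Z b) y \<partial>lborel)"
proof -
  define d where "d = real_of_int (dg x0)"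
  have d1: "d \<ge> 1" using digit_pos[OF adj Z_D(1,3)[OF x0]] by (simp add: d_def)
  have pos: "d + real b > 0" using d1 by (simp add: add_pos_nonneg)
  \<comment> \<open>Forwards, the bounds on \<open>T x\<close> confine
    \<open>x = N / (d + T x)\<close>; backwards, \<open>inverse_branch\<close> is applied to
    \<open>y = N / x - d\<close>.\<close>
  have mem: "x \<in> Z a \<and> dg x = dg x0 \<longleftrightarrow> x \<in> {real N / (d + real b + 1)..real N / (d + real b)}"
    if "x \<notin> \<rat>" for x
  proof
    assume x: "x \<in> Z a \<and> dg x = dg x0"
    then have "T x \<in> Z b" "real N / (d + T x) = x" using T_Z[OF adj, of x] by (auto simp: d_def)
    moreover from this have "d + T x > 0" "real b < T x" "T x < real b + 1"
      using Z_D[of "T x" b] d1 by auto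
    then have "real N / (d + T x) \<in> {real N / (d + real b + 1)..real N / (d + real b)}"
      using pos by (auto intro!: divide_left_mono mult_pos_pos)
    ultimately show "x \<in> {real N / (d + real b + 1)..real N / (d + real b)}"
      by simp
  next
    assume x: "x \<in> {real N / (d + real b + 1)..real N / (d + real b)}"
    have "0 < real N / (d + real b + 1)" using pos N_pos by auto
    then have xpos: "x > 0" using x by (auto intro: less_le_trans)
    define y where "y = real N / x - d"
    have "real N / x \<notin> \<rat>" using that xpos Rats_div_iff by auto
    then have yr: "y \<notin> \<rat>" unfolding y_def d_def using Rats_add_int_iff[of "dg x0" y] by (simp add: y_def d_def)
    have "y \<ge> real b" "y \<le> real b + 1" using x xpos pos by (auto simp: y_def field_simps)
    moreover have "y \<noteq> real b + 1" using yr by (metis Rats_1 Rats_add Rats_of_nat)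
    ultimately have "y \<in> Z b" using yr by (simp add: Z_def unit_ival_def)
    from inverse_branch[OF adj x0 this] show "x \<in> Z a \<and> dg x = dg x0"
      using xpos N_pos by (simp add: y_def d_def)
  qed
  have "(\<integral>\<^sup>+x. f x * indicator {x \<in> Z a. dg x = dg x0} x \<partial>lborel)
      = (\<integral>\<^sup>+x. f x * indicator {real N / (d + real b + 1)..real N / (d + real b)} x \<partial>lborel)"
    by (rule nn_integral_cong_AE, use AE_not_Rats in eventually_elim)
       (use mem in \<open>auto simp: indicator_def\<close>)
  also have "\<dots> = (\<integral>\<^sup>+y. f (real N / y) * ennreal (real N / y\<^sup>2)
      * indicator {d + real b..d + real b + 1} y \<partial>lborel)"
    by (rule nn_integral_reciprocal_subst) (use N_pos pos in auto)
  also have "\<dots> = (\<integral>\<^sup>+y. f (real N / (d + y)) * ennreal (real N / (d + y)\<^sup>2)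
      * indicator {d + real b..d + real b + 1} (d + y) \<partial>lborel)"
    by (subst nn_integral_real_affine[of _ 1 d]) auto
  also have "\<dots> = (\<integral>\<^sup>+y. f (real N / (d + y)) * ennreal (real N / (d + y)\<^sup>2)
        * indicator (Z b) y \<partial>lborel)"
  proof (rule nn_integral_cong_AE, use AE_not_Rats in eventually_elim)
    fix y :: real assume "y \<notin> \<rat>"
    moreover have "y \<noteq> real b + 1" using \<open>y \<notin> \<rat>\<close> by (metis Rats_1 Rats_add Rats_of_nat)
    ultimately show "f (real N / (d + y)) * ennreal (real N / (d + y)\<^sup>2)
        * indicator {d + real b..d + real b + 1} (d + y)
      = f (real N / (d + y)) * ennreal (real N / (d + y)\<^sup>2) * indicator (Z b) y"
      by (auto simp: indicator_def Z_def unit_ival_def)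
  qed
  finally show ?thesis by (simp add: d_def)
qed

abbreviation ker :: "real \<times> real \<Rightarrow> real" where "ker \<equiv> ext_kernel N"

lemma ker_nonneg [simp]: "ker z \<ge> 0"
  by (simp add: ext_kernel_def split: prod.split)

lemma ker_measurable [measurable]: "ker \<in> borel_measurable borel"
  unfolding ext_kernel_def borel_prod[symmetric] by measurable

text \<open>The point \<open>(N / (d + u), N / v - d)\<close> is the preimage of
  \<open>(u, v)\<close> under the branch with digit \<open>d\<close>, and the two factors are the
  absolute derivatives of its coordinates. Everything rests on
  \<open>N + x y = N (N + u v) / (v (d + u))\<close>.\<close>

lemma kernel_invariant:
  fixes d u v :: real
  assumes u: "u \<ge> 0" and v: "v > 0" and d: "d > 0" and w: "real N / v - d \<ge> 0"
  shows "ker (real N / (d + u), real N / v - d) * (real N / v\<^sup>2) * (real N / (d + u)\<^sup>2) = ker (u, v)"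
proof -
  have p: "d + u > 0" "real N + u * v > 0" using u v d N_pos by (auto simp: add_pos_nonneg)
  have "real N + real N / (d + u) * (real N / v - d) = real N * (real N + u * v) / (v * (d + u))"
    using p v by (simp add: divide_simps) (simp add: algebra_simps)
  then have "ker (real N / (d + u), real N / v - d)
      = real N * (v * (d + u))\<^sup>2 / (real N * (real N + u * v))\<^sup>2"
    by (simp add: ext_kernel_def power_divide)
  \<comment> \<open>The two sums become atoms \<open>A\<close> and \<open>B\<close>, so that the
    cancellation is done without multiplying them out.\<close>
  then have "ker (real N / (d + u), real N / v - d) * (real N / v\<^sup>2) * (real N / (d + u)\<^sup>2)
      = real N * (v * B)\<^sup>2 / (real N * A)\<^sup>2 * (real N / v\<^sup>2) * (real N / B\<^sup>2)"
    if "A = real N + u * v" "B = d + u" for A B by (simp add: that)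
  moreover have "real N * (v * B)\<^sup>2 / (real N * A)\<^sup>2 * (real N / v\<^sup>2) * (real N / B\<^sup>2) = real N / A\<^sup>2"
    if "A > 0" "B > 0" for A B
    using that v N_pos by (simp add: field_simps power2_eq_square)
  ultimately show ?thesis using p by (simp add: ext_kernel_def)
qed

text \<open>Two one-dimensional substitutions replace a planar one: with \<open>x\<close> fixed,
  \<open>y\<close> is exchanged for \<open>v = N / (d + y)\<close>; after Tonelli, with
  \<open>v\<close> fixed, \<open>x\<close> is exchanged for \<open>u = T x\<close>. In between, the
  domain is described by the symmetric condition that \<open>x\<close> and \<open>v\<close> have the
  same digit.\<close>

lemma nn_integral_S_block:
  fixes g :: "real \<times> real \<Rightarrow> ennreal"
  assumes adj: "adj a b" and [measurable]: "g \<in> borel_measurable borel"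
  shows "(\<integral>\<^sup>+z. g (S z) * ker z * indicator (Z a \<times> Z b) z \<partial>lborel)
    = (\<integral>\<^sup>+z. g z * ker z * indicator (Z b \<times> Z a) z \<partial>lborel)"
proof -
  note [measurable] = borel_prod[symmetric]
  have m[measurable]: "g \<in> borel_measurable (borel \<Otimes>\<^sub>M borel)" "ker \<in> borel_measurable (borel \<Otimes>\<^sub>M borel)"
      "S \<in> measurable (borel \<Otimes>\<^sub>M borel) (borel \<Otimes>\<^sub>M borel)"
    using assms(2) ker_measurable S_measurable unfolding borel_prod by auto
  have "(\<integral>\<^sup>+z. g (S z) * ker z * indicator (Z a \<times> Z b) z \<partial>lborel)
      = (\<integral>\<^sup>+x. (\<integral>\<^sup>+y. g (S (x, y)) * ker (x, y) * indicator (Z a \<times> Z b) (x, y) \<partial>lborel) \<partial>lborel)"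
    unfolding lborel_prod[symmetric] by (rule lborel.nn_integral_fst[symmetric]) measurable
  also have "\<dots> = (\<integral>\<^sup>+x. (\<integral>\<^sup>+v. (g (T x, v) * ker (x, T v) * ennreal (real N / v\<^sup>2)) *
      indicator (Z a) x * indicator (Z a) v * of_bool (dg x = dg v) \<partial>lborel) \<partial>lborel)"
  proof (rule nn_integral_cong)
    fix x :: real
    show "(\<integral>\<^sup>+y. g (S (x, y)) * ker (x, y) * indicator (Z a \<times> Z b) (x, y) \<partial>lborel)
      = (\<integral>\<^sup>+v. (g (T x, v) * ker (x, T v) * ennreal (real N / v\<^sup>2)) *
      indicator (Z a) x * indicator (Z a) v * of_bool (dg x = dg v) \<partial>lborel)"
    proof (cases "x \<in> Z a")
      case x: True
      have "(\<integral>\<^sup>+v. (g (T x, v) * ker (x, T v) * ennreal (real N / v\<^sup>2)) *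
      indicator (Z a) x * indicator (Z a) v * of_bool (dg x = dg v) \<partial>lborel)
        = (\<integral>\<^sup>+v. (g (T x, v) * ker (x, T v) * ennreal (real N / v\<^sup>2)) * indicator {v \<in> Z a. dg v = dg x} v \<partial>lborel)"
        using x by (intro nn_integral_cong) (auto simp: indicator_def)
      also have "\<dots> = (\<integral>\<^sup>+y. g (T x, real N / (of_int (dg x) + y)) * ker (x, T (real N / (of_int (dg x) + y)))
         * ennreal (real N / (real N / (of_int (dg x) + y))\<^sup>2) *
         ennreal (real N / (of_int (dg x) + y)\<^sup>2) * indicator (Z b) y \<partial>lborel)"
        by (rule nn_integral_branch[OF adj x]) measurable
      also have "\<dots> = (\<integral>\<^sup>+y. g (S (x, y)) * ker (x, y) * indicator (Z a \<times> Z b) (x, y) \<partial>lborel)"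
      proof (rule nn_integral_cong)
        fix y :: real
        define w where "w = of_int (dg x) + y"
        \<comment> \<open>The branch formula is read from \<open>v\<close> back to \<open>y\<close>,
          so the weight \<open>N / v\<^sup>2\<close> at \<open>v = N / w\<close> cancels the
          Jacobian \<open>N / w\<^sup>2\<close>.\<close>
        have "ennreal (real N / (real N / w)\<^sup>2) * ennreal (real N / w\<^sup>2) = 1" if "y \<in> Z b"
        proof -
          have "w > 0" using that digit_pos[OF adj Z_D(1,3)[OF x]] Z_D(6)[of y b]
            by (simp add: w_def add_pos_pos)
          then show ?thesis using N_pos
            by (subst ennreal_mult'[symmetric]) (auto simp: power2_eq_square)
        qed
        then show "g (T x, real N / (of_int (dg x) + y)) * ker (x, T (real N / (of_int (dg x) + y)))
         * ennreal (real N / (real N / (of_int (dg x) + y))\<^sup>2) *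
         ennreal (real N / (of_int (dg x) + y)\<^sup>2) * indicator (Z b) y
         = g (S (x, y)) * ker (x, y) * indicator (Z a \<times> Z b) (x, y)"
          unfolding w_def[symmetric] using inverse_branch(3)[OF adj x, of y]
          by (cases "y \<in> Z b") (auto simp: x ext_map_def w_def mult.assoc)
      qed
      finally show ?thesis ..
    qed simp
  qed
  also have "\<dots> = (\<integral>\<^sup>+v. (\<integral>\<^sup>+x. (g (T x, v) * ker (x, T v) * ennreal (real N / v\<^sup>2)) *
      indicator (Z a) x * indicator (Z a) v * of_bool (dg x = dg v) \<partial>lborel) \<partial>lborel)"
    by (rule lborel_pair.Fubini') measurable
  also have "\<dots> = (\<integral>\<^sup>+v. (\<integral>\<^sup>+u. g (u, v) * ker (u, v) * indicator (Z b \<times> Z a) (u, v) \<partial>lborel) \<partial>lborel)"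
  proof (rule nn_integral_cong)
    fix v :: real
    show "(\<integral>\<^sup>+x. (g (T x, v) * ker (x, T v) * ennreal (real N / v\<^sup>2)) *
      indicator (Z a) x * indicator (Z a) v * of_bool (dg x = dg v) \<partial>lborel)
      = (\<integral>\<^sup>+u. g (u, v) * ker (u, v) * indicator (Z b \<times> Z a) (u, v) \<partial>lborel)"
    proof (cases "v \<in> Z a")
      case v: True
      have "(\<integral>\<^sup>+x. (g (T x, v) * ker (x, T v) * ennreal (real N / v\<^sup>2)) *
      indicator (Z a) x * indicator (Z a) v * of_bool (dg x = dg v) \<partial>lborel)
        = (\<integral>\<^sup>+x. (g (T x, v) * ker (x, T v) * ennreal (real N / v\<^sup>2)) * indicator {x \<in> Z a. dg x = dg v} x \<partial>lborel)"
        using v by (intro nn_integral_cong) (auto simp: indicator_def)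
      also have "\<dots> = (\<integral>\<^sup>+u. g (T (real N / (of_int (dg v) + u)), v) * ker (real N / (of_int (dg v) + u), T v)
         * ennreal (real N / v\<^sup>2) *
         ennreal (real N / (of_int (dg v) + u)\<^sup>2) * indicator (Z b) u \<partial>lborel)"
        by (rule nn_integral_branch[OF adj v]) measurable
      also have "\<dots> = (\<integral>\<^sup>+u. g (u, v) * ker (u, v) * indicator (Z b \<times> Z a) (u, v) \<partial>lborel)"
      proof (rule nn_integral_cong)
        fix u :: real
        have "ennreal (ker (real N / (of_int (dg v) + u), T v)) * ennreal (real N / v\<^sup>2)
          * ennreal (real N / (of_int (dg v) + u)\<^sup>2) = ennreal (ker (u, v))" if u: "u \<in> Z b"
        proof -
          have Tv: "T v = real N / v - of_int (dg v)" by (rule T_eq[OF adj Z_D(1,3)[OF v]])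
          have "ker (real N / (of_int (dg v) + u), T v) * (real N / v\<^sup>2) * (real N / (of_int (dg v) + u)\<^sup>2) = ker (u, v)"
            unfolding Tv using T_Z(1)[OF adj v] digit_pos[OF adj Z_D(1,3)[OF v]]
            by (intro kernel_invariant) (use Z_D(6)[OF u] Z_D(6)[OF v] Z_D(6)[of "T v" b] Tv in auto)
          then show ?thesis
            by (simp add: ennreal_mult[symmetric] del: ennreal_mult)
        qed
        then show "g (T (real N / (of_int (dg v) + u)), v) * ker (real N / (of_int (dg v) + u), T v)
         * ennreal (real N / v\<^sup>2) *
         ennreal (real N / (of_int (dg v) + u)\<^sup>2) * indicator (Z b) u
         = g (u, v) * ker (u, v) * indicator (Z b \<times> Z a) (u, v)"
          using inverse_branch(3)[OF adj v, of u] by (cases "u \<in> Z b") (auto simp: v mult.assoc)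
      qed
      finally show ?thesis .
    qed simp
  qed
  also have "\<dots> = (\<integral>\<^sup>+z. g z * ker z * indicator (Z b \<times> Z a) z \<partial>lborel)"
    unfolding lborel_prod[symmetric] by (rule lborel_pair.nn_integral_snd) measurable
  finally show ?thesis .
qed

section \<open>Total mass\<close>

abbreviation X :: "(real \<times> real) set" where "X \<equiv> ext_dom a1 a2"
abbreviation \<nu> :: "(real \<times> real) measure" where "\<nu> \<equiv> ext_measure a1 a2 N"
abbreviation C :: real where "C \<equiv> norm_const a1 a2 N"

text \<open>\<open>Y\<close> has full measure in \<open>X\<close>, and \<open>S\<close> is a genuine bijection of \<open>Y\<close>.\<close>
definition Y :: "(real \<times> real) set" where
  "Y = Z a1 \<times> Z a2 \<union> Z a2 \<times> Z a1"

text \<open>The integral of the kernel over one of the two rectangles. Its symmetry in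
  \<open>a\<close> and \<open>b\<close> is the source of the factor \<open>2\<close> in the
  normalising constant.\<close>

definition block_mass :: "nat \<Rightarrow> nat \<Rightarrow> real" where
  "block_mass a b = ln (1 + real N / ((real N + real a * (real b + 1)) * (real N + real b * (real a + 1))))"

lemma block_mass_pos: "block_mass a b > 0"
proof -
  have "(real N + real a * (real b + 1)) * (real N + real b * (real a + 1)) > 0"
    using N_pos by (intro mult_pos_pos add_pos_nonneg) auto
  then have "real N / ((real N + real a * (real b + 1)) * (real N + real b * (real a + 1))) > 0"
    using N_pos by (intro divide_pos_pos)
  then show ?thesis unfolding block_mass_def by (intro ln_gt_zero) linarith
qed

lemma block_mass_sym: "block_mass a b = block_mass b a"
  by (simp add: block_mass_def mult.commute)

text \<open>In the variable \<open>y\<close> the kernel has the antiderivative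
  \<open>y / (N + x y)\<close>.\<close>

lemma nn_integral_ker_snd:
  assumes x: "x \<ge> 0"
  shows "(\<integral>\<^sup>+y. ennreal (ker (x, y)) * indicator {real b..real b + 1} y \<partial>lborel)
    = ennreal ((real b + 1) / (real N + x * (real b + 1)) - real b / (real N + x * real b))"
proof (rule nn_integral_FTC_Icc)
  show "(\<lambda>y. ker (x, y)) \<in> borel_measurable borel"
    unfolding ext_kernel_def prod.case by measurable
  show "((\<lambda>y. y / (real N + x * y)) has_real_derivative ker (x, y)) (at y)"
    if "y \<in> {real b..real b + 1}" for y
  proof -
    have "y \<ge> 0" using that by (auto intro: order_trans[OF of_nat_0_le_iff])
    then have "real N + x * y > 0" using N_pos x by (simp add: add_pos_nonneg)
    then show ?thesis
      by (auto intro!: derivative_eq_intros simp: ext_kernel_def power2_eq_square algebra_simps)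
  qed
qed auto

lemma nn_integral_ker_block:
  "(\<integral>\<^sup>+z. ennreal (ker z) * indicator (unit_ival a \<times> {real b..real b + 1}) z \<partial>lborel) = ennreal (block_mass a b)"
proof -
  define h where "h = (\<lambda>x::real. (real b + 1) / (real N + x * (real b + 1)) - real b / (real N + x * real b))"
  have [measurable]: "ker \<in> borel_measurable (borel \<Otimes>\<^sub>M borel)"
    using ker_measurable unfolding borel_prod .
  have pos: "real N + x * (real b + 1) > 0" "real N + x * real b > 0" if "x \<ge> 0" for x
    using that N_pos by (auto simp: add_pos_nonneg)
  have "(\<integral>\<^sup>+z. ennreal (ker z) * indicator (unit_ival a \<times> {real b..real b + 1}) z \<partial>lborel)
    = (\<integral>\<^sup>+x. (\<integral>\<^sup>+y. ennreal (ker (x, y)) * indicator (unit_ival a \<times> {real b..real b + 1}) (x, y) \<partial>lborel) \<partial>lborel)"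
    unfolding lborel_prod[symmetric] by (rule lborel.nn_integral_fst[symmetric]) measurable
  also have "\<dots> = (\<integral>\<^sup>+x. ennreal (h x) * indicator {real a..real a + 1} x \<partial>lborel)"
  proof (rule nn_integral_cong_AE, use AE_not_Rats in eventually_elim)
    fix x :: real assume "x \<notin> \<rat>"
    then have ne: "x \<noteq> real a + 1" by (metis Rats_1 Rats_add Rats_of_nat)
    show "(\<integral>\<^sup>+y. ennreal (ker (x, y)) * indicator (unit_ival a \<times> {real b..real b + 1}) (x, y) \<partial>lborel)
        = ennreal (h x) * indicator {real a..real a + 1} x"
    proof (cases "x \<in> unit_ival a")
      case True
      then have "x \<ge> 0" by (auto simp: unit_ival_def intro: order_trans[OF of_nat_0_le_iff])
      from nn_integral_ker_snd[OF this, of b] show ?thesis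
        using True by (auto simp: unit_ival_def h_def indicator_def)
    qed (use ne in \<open>auto simp: unit_ival_def indicator_def\<close>)
  qed
  also have "\<dots> = ennreal ((ln (real N + (real a + 1) * (real b + 1)) - ln (real N + (real a + 1) * real b))
      - (ln (real N + real a * (real b + 1)) - ln (real N + real a * real b)))"
  proof (rule nn_integral_FTC_Icc[where F = "\<lambda>x. ln (real N + x * (real b + 1)) - ln (real N + x * real b)"])
    show "h \<in> borel_measurable borel" unfolding h_def by measurable
    fix x assume "x \<in> {real a..real a + 1}"
    then have x: "x \<ge> 0" by (auto intro: order_trans[OF of_nat_0_le_iff])
    show "((\<lambda>x. ln (real N + x * (real b + 1)) - ln (real N + x * real b)) has_real_derivative h x) (at x)"
      using pos[OF x] by (auto intro!: derivative_eq_intros simp: h_def)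
    show "0 \<le> h x" using pos[OF x] N_pos x by (auto simp: h_def field_simps)
  qed auto
  also have "(ln (real N + (real a + 1) * (real b + 1)) - ln (real N + (real a + 1) * real b))
      - (ln (real N + real a * (real b + 1)) - ln (real N + real a * real b)) = block_mass a b"
  proof -
    define P Q R V where "P = real N + (real a + 1) * (real b + 1)" "Q = real N + (real a + 1) * real b"
      "R = real N + real a * (real b + 1)" "V = real N + real a * real b"
    then have "P > 0" "Q > 0" "R > 0" "V > 0" using N_pos by (auto intro: add_pos_nonneg)
    then have "(ln P - ln Q) - (ln R - ln V) = ln (P * V / (R * Q))"
      by (simp add: ln_mult ln_div)
    \<comment> \<open>All terms but a single \<open>N\<close> cancel, which is how four logarithms
      collapse into the one of \<open>block_mass\<close>.\<close>
    also have "P * V = R * Q + real N" unfolding P_Q_R_V_def by (simp add: algebra_simps)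
    also have "(R * Q + real N) / (R * Q) = 1 + real N / (R * Q)"
      using \<open>R > 0\<close> \<open>Q > 0\<close> by (simp add: field_simps)
    finally show ?thesis unfolding P_Q_R_V_def block_mass_def by (simp add: mult.commute)
  qed
  finally show ?thesis .
qed

lemma X_eq: "X = unit_ival a1 \<times> {real a2..real a2 + 1} \<union> unit_ival a2 \<times> {real a1..real a1 + 1}"
  by (simp add: ext_dom_def unit_ival_def)

lemma X_disjoint: "unit_ival a1 \<times> {real a2..real a2 + 1} \<inter> unit_ival a2 \<times> {real a1..real a1 + 1} = {}"
  using unit_ival_disjoint[of a1 a2] by (auto simp: adj_def)

lemma Times_borel: "A \<in> sets borel \<Longrightarrow> B \<in> sets borel \<Longrightarrow> A \<times> B \<in> sets (borel :: (real \<times> real) measure)"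
  unfolding borel_prod[symmetric] by (rule pair_measureI)

lemma X_borel [measurable]: "X \<in> sets borel"
  unfolding X_eq by (intro sets.Un Times_borel) auto

lemma Y_borel [measurable]: "Y \<in> sets borel"
  unfolding Y_def by (intro sets.Un Times_borel) auto

lemma nn_integral_ker_X: "(\<integral>\<^sup>+z. ennreal (ker z) * indicator X z \<partial>lborel) = ennreal (2 * block_mass a1 a2)"
proof -
  have [measurable]: "unit_ival a \<times> {real b..real b + 1} \<in> sets borel" for a b
    by (intro Times_borel) auto
  have "(\<integral>\<^sup>+z. ennreal (ker z) * indicator X z \<partial>lborel)
    = (\<integral>\<^sup>+z. ennreal (ker z) * indicator (unit_ival a1 \<times> {real a2..real a2 + 1}) z
        + ennreal (ker z) * indicator (unit_ival a2 \<times> {real a1..real a1 + 1}) z \<partial>lborel)"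
    using X_disjoint by (intro nn_integral_cong) (auto simp: X_eq indicator_def)
  also have "\<dots> = ennreal (block_mass a1 a2) + ennreal (block_mass a2 a1)"
    by (subst nn_integral_add) (auto simp: nn_integral_ker_block)
  also have "\<dots> = ennreal (2 * block_mass a1 a2)"
    using block_mass_pos[of a1 a2] by (simp add: block_mass_sym[of a2] ennreal_plus[symmetric] del: ennreal_plus)
  finally show ?thesis .
qed

text \<open>Bridges the real-valued integrals of the statement and the extended nonnegative ones of
  the computations; the finite mass of \<open>X\<close> dominates.\<close>

lemma ker_integrable:
  assumes [measurable]: "A \<in> sets borel" and "A \<subseteq> X"
  shows "set_integrable lborel A ker"
    and "(\<integral>\<^sup>+z. ennreal (ker z) * indicator A z \<partial>lborel) = ennreal (set_lebesgue_integral lborel A ker)"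
proof -
  have eq: "ennreal (norm (indicat_real A z *\<^sub>R ker z)) = ennreal (ker z) * indicator A z" for z
    by (auto simp: indicator_def)
  have "(\<integral>\<^sup>+z. ennreal (ker z) * indicator A z \<partial>lborel) \<le> (\<integral>\<^sup>+z. ennreal (ker z) * indicator X z \<partial>lborel)"
    using assms(2) by (intro nn_integral_mono) (auto simp: indicator_def)
  then have fin: "(\<integral>\<^sup>+z. ennreal (ker z) * indicator A z \<partial>lborel) < \<infinity>"
    unfolding nn_integral_ker_X by (auto simp: top.not_eq_extremum intro: le_less_trans)
  then show int: "set_integrable lborel A ker"
    unfolding set_integrable_def by (intro integrableI_bounded) (simp_all only: eq, measurable)
  have "(\<integral>\<^sup>+z. ennreal (indicat_real A z *\<^sub>R ker z) \<partial>lborel) = ennreal (set_lebesgue_integral lborel A ker)"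
    unfolding set_lebesgue_integral_def
    by (rule nn_integral_eq_integral[OF int[unfolded set_integrable_def]]) auto
  also have "(\<integral>\<^sup>+z. ennreal (indicat_real A z *\<^sub>R ker z) \<partial>lborel) = (\<integral>\<^sup>+z. ennreal (ker z) * indicator A z \<partial>lborel)"
    by (intro nn_integral_cong) (auto simp: indicator_def)
  finally show "(\<integral>\<^sup>+z. ennreal (ker z) * indicator A z \<partial>lborel) = ennreal (set_lebesgue_integral lborel A ker)" .
qed

lemma integral_ker_X: "set_lebesgue_integral lborel X ker = 2 * block_mass a1 a2"
proof -
  have "set_lebesgue_integral lborel X ker \<ge> 0"
    unfolding set_lebesgue_integral_def by (intro integral_nonneg_AE) auto
  moreover have "ennreal (set_lebesgue_integral lborel X ker) = ennreal (2 * block_mass a1 a2)"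
    using ker_integrable(2)[of X] nn_integral_ker_X by simp
  ultimately show ?thesis using block_mass_pos[of a1 a2] by (simp add: ennreal_inj)
qed

lemma C_pos: "C > 0"
  using block_mass_pos[of a1 a2] by (simp add: norm_const_def integral_ker_X)

section \<open>The planar probability measure\<close>

lemma space_nu [simp]: "space \<nu> = X"
  by (simp add: ext_measure_def space_restrict_space)

lemma sets_nu: "sets \<nu> = sets (restrict_space borel X)"
  by (simp add: ext_measure_def) (rule sets_restrict_space_cong, simp)

lemma sets_nu_iff: "A \<in> sets \<nu> \<longleftrightarrow> A \<in> sets borel \<and> A \<subseteq> X"
  unfolding sets_nu by (subst sets_restrict_space_iff) auto

lemma emeasure_nu:
  assumes "A \<in> sets borel" "A \<subseteq> X"
  shows "emeasure \<nu> A = ennreal C * (\<integral>\<^sup>+z. ennreal (ker z) * indicator A z \<partial>lborel)"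
proof -
  have [measurable]: "A \<in> sets borel" by fact
  have A: "A \<in> sets (restrict_space lborel X)"
    using assms by (subst sets_restrict_space_iff) auto
  have "emeasure \<nu> A = (\<integral>\<^sup>+z. ennreal (C * ker z) * indicator A z \<partial>restrict_space lborel X)"
    unfolding ext_measure_def
    by (rule emeasure_density[OF _ A]) (intro measurable_restrict_space1, measurable)
  also have "\<dots> = (\<integral>\<^sup>+z. ennreal (C * ker z) * indicator A z * indicator X z \<partial>lborel)"
    by (subst nn_integral_restrict_space) auto
  also have "\<dots> = (\<integral>\<^sup>+z. ennreal C * (ennreal (ker z) * indicator A z) \<partial>lborel)"
    using assms(2) C_pos by (intro nn_integral_cong) (auto simp: indicator_def ennreal_mult')
  also have "\<dots> = ennreal C * (\<integral>\<^sup>+z. ennreal (ker z) * indicator A z \<partial>lborel)"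
    by (rule nn_integral_cmult) measurable
  finally show ?thesis .
qed

lemma measure_nu:
  assumes "A \<in> sets (restrict_space borel X)"
  shows "measure \<nu> A = C * set_lebesgue_integral lborel A ker"
proof -
  have A: "A \<in> sets borel" "A \<subseteq> X" using assms sets_nu_iff sets_nu by auto
  have "set_lebesgue_integral lborel A ker \<ge> 0"
    unfolding set_lebesgue_integral_def by (intro integral_nonneg_AE) auto
  then show ?thesis
    unfolding measure_def emeasure_nu[OF A] ker_integrable(2)[OF A]
    using C_pos by (simp add: ennreal_mult'[symmetric])
qed

lemma prob_space_nu: "prob_space \<nu>"
proof
  show "emeasure \<nu> (space \<nu>) = 1"
    using emeasure_nu[OF X_borel order_refl] C_pos block_mass_pos[of a1 a2]
    by (simp add: nn_integral_ker_X ennreal_mult[symmetric]) (simp add: norm_const_def integral_ker_X)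
qed

section \<open>Reduction to irrational coordinates\<close>

lemma AE_prod_not_Rats: "AE z in (lborel :: (real \<times> real) measure). fst z \<notin> \<rat> \<and> snd z \<notin> \<rat>"
proof -
  have q: "emeasure lborel (\<rat> :: real set) = 0" by (rule emeasure_lborel_countable[OF countable_rat])
  have "emeasure lborel ((\<rat> :: real set) \<times> (UNIV :: real set)) = emeasure lborel (\<rat> :: real set) * emeasure lborel (UNIV :: real set)"
    unfolding lborel_prod[symmetric] by (rule lborel.emeasure_pair_measure_Times) auto
  moreover have "emeasure lborel ((UNIV :: real set) \<times> (\<rat> :: real set)) = emeasure lborel (UNIV :: real set) * emeasure lborel (\<rat> :: real set)"
    unfolding lborel_prod[symmetric] by (rule lborel.emeasure_pair_measure_Times) auto
  ultimately have "\<rat> \<times> UNIV \<in> null_sets (lborel :: (real \<times> real) measure)"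
     "UNIV \<times> \<rat> \<in> null_sets (lborel :: (real \<times> real) measure)"
    using q by (auto simp: null_sets_def intro!: Times_borel)
  then have "\<rat> \<times> UNIV \<union> UNIV \<times> \<rat> \<in> null_sets (lborel :: (real \<times> real) measure)" by auto
  then show ?thesis by (rule AE_I') auto
qed

lemma Y_subset_X: "Y \<subseteq> X"
  by (auto simp: Y_def X_eq unit_ival_def Z_def)

text \<open>\<open>X\<close> and \<open>Y\<close> differ only in points on countably many horizontal
  and vertical lines.\<close>

lemma AE_X_iff_Y: "AE z in lborel. z \<in> X \<longleftrightarrow> z \<in> Y"
  using AE_prod_not_Rats
proof eventually_elim
  fix z :: "real \<times> real" assume z: "fst z \<notin> \<rat> \<and> snd z \<notin> \<rat>"
  have ne: "snd z \<noteq> real n + 1" for n using z by (metis Rats_1 Rats_add Rats_of_nat)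
  have "z \<in> unit_ival a \<times> {real b..real b + 1} \<longleftrightarrow> z \<in> Z a \<times> Z b" for a b
    using z ne[of b] by (cases z) (auto simp: Z_def unit_ival_def)
  then show "z \<in> X \<longleftrightarrow> z \<in> Y" by (simp add: X_eq Y_def)
qed

lemma emeasure_nu_Int_Y:
  assumes "A \<in> sets borel"
  shows "emeasure \<nu> (A \<inter> X) = emeasure \<nu> (A \<inter> Y)"
proof -
  have "(\<integral>\<^sup>+z. ennreal (ker z) * indicator (A \<inter> X) z \<partial>lborel) = (\<integral>\<^sup>+z. ennreal (ker z) * indicator (A \<inter> Y) z \<partial>lborel)"
    by (rule nn_integral_cong_AE, use AE_X_iff_Y in eventually_elim) (auto simp: indicator_def)
  then show ?thesis
    using assms Y_subset_X by (subst (1 2) emeasure_nu) auto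
qed

lemma nu_X_minus_Y: "emeasure \<nu> (X - Y) = 0"
proof -
  have "emeasure \<nu> (X - Y) = emeasure \<nu> (- Y \<inter> X)" by (rule arg_cong[of _ _ "emeasure \<nu>"]) auto
  also have "\<dots> = emeasure \<nu> (- Y \<inter> Y)" by (rule emeasure_nu_Int_Y) auto
  finally show ?thesis by simp
qed

lemma Z_disjoint: "Z a1 \<inter> Z a2 = {}"
  using unit_ival_disjoint[of a1 a2] by (auto simp: adj_def dest: Z_D)

text \<open>\<open>S\<close> interchanges the two blocks of \<open>Y\<close>, so the block
  identities give back the same two summands in the opposite order.\<close>

lemma emeasure_nu_S_vimage:
  assumes A: "A \<in> sets borel"
  shows "emeasure \<nu> (S -` A \<inter> Y) = emeasure \<nu> (A \<inter> Y)"
proof -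
  have [measurable]: "A \<in> sets borel" by fact
  have Zb[measurable]: "Z a \<times> Z b \<in> sets borel" for a b by (intro Times_borel) auto
  have [measurable]: "S -` A \<in> sets borel"
    using measurable_sets[OF S_measurable A] by simp
  have split: "ennreal (ker z) * indicator (B \<inter> Y) z = indicator B z * ennreal (ker z) * indicator (Z a1 \<times> Z a2) z
      + indicator B z * ennreal (ker z) * indicator (Z a2 \<times> Z a1) z" for B and z :: "real \<times> real"
    using Z_disjoint by (auto simp: Y_def indicator_def)
  have S': "indicator (S -` A) z = (indicator A (S z) :: ennreal)" for z by (auto simp: indicator_def)
  have a: "adj a1 a2" "adj a2 a1" by (auto simp: adj_def)
  have "(\<integral>\<^sup>+z. ennreal (ker z) * indicator (S -` A \<inter> Y) z \<partial>lborel)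
      = (\<integral>\<^sup>+z. indicator A (S z) * ennreal (ker z) * indicator (Z a1 \<times> Z a2) z \<partial>lborel)
      + (\<integral>\<^sup>+z. indicator A (S z) * ennreal (ker z) * indicator (Z a2 \<times> Z a1) z \<partial>lborel)"
    unfolding split S' by (rule nn_integral_add) measurable
  also have "\<dots> = (\<integral>\<^sup>+z. indicator A z * ennreal (ker z) * indicator (Z a2 \<times> Z a1) z \<partial>lborel)
      + (\<integral>\<^sup>+z. indicator A z * ennreal (ker z) * indicator (Z a1 \<times> Z a2) z \<partial>lborel)"
    by (simp add: nn_integral_S_block[OF a(1)] nn_integral_S_block[OF a(2)])
  also have "\<dots> = (\<integral>\<^sup>+z. ennreal (ker z) * indicator (A \<inter> Y) z \<partial>lborel)"
    unfolding split by (subst add.commute, rule nn_integral_add[symmetric]) measurable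
  finally show ?thesis
    using Y_subset_X by (subst (1 2) emeasure_nu) auto
qed

section \<open>Invertibility and the marginal measure\<close>

abbreviation Om :: "real set" where "Om \<equiv> Omega a1 a2"

lemma Y_cases:
  assumes "z \<in> Y"
  obtains a b x y where "z = (x, y)" "adj a b" "x \<in> Z a" "y \<in> Z b"
  using assms by (auto simp: Y_def adj_def)

lemma Y_I: "adj a b \<Longrightarrow> x \<in> Z a \<Longrightarrow> y \<in> Z b \<Longrightarrow> (x, y) \<in> Y"
  by (auto simp: Y_def adj_def)

lemma swap_Y: "prod.swap z \<in> Y \<longleftrightarrow> z \<in> Y"
  by (cases z) (auto simp: Y_def)

lemma S_Pair: "S (x, y) = (T x, real N / (of_int (dg x) + y))"
  by (simp add: ext_map_def)

lemma fst_S: "fst (S z) = T (fst z)"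
  by (cases z) (simp add: S_Pair)

text \<open>A step of \<open>S\<close> stores the digit of the first coordinate in the second, where
  \<open>dg\<close> reads it off again. No information is lost, and the same map with the
  coordinates exchanged undoes the step.\<close>

lemma
  assumes "z \<in> Y"
  shows S_Y: "S z \<in> Y"
    and digit_snd_S: "dg (snd (S z)) = dg (fst z)"
    and swap_S_involution: "prod.swap (S (prod.swap (S z))) = z"
  using assms
proof -
  obtain a b x y where z: "z = (x, y)" "adj a b" "x \<in> Z a" "y \<in> Z b"
    using assms by (rule Y_cases)
  note i = inverse_branch[OF z(2-4)] and t = T_Z[OF z(2,3)]
  show "S z \<in> Y" using Y_I[OF adj_sym[OF z(2)] t(1) i(1)] by (simp add: z S_Pair)
  show "dg (snd (S z)) = dg (fst z)" using i(2) by (simp add: z S_Pair)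
  show "prod.swap (S (prod.swap (S z))) = z" using i(2,3) t(2) by (simp add: z S_Pair)
qed

text \<open>An explicit inverse on \<open>Y\<close>, from which measurability and the behaviour of
  backward orbits can be read off.\<close>

definition Sinv :: "real \<times> real \<Rightarrow> real \<times> real" where
  "Sinv z = prod.swap (S (prod.swap z))"

lemma
  assumes "z \<in> Y"
  shows Sinv_Y: "Sinv z \<in> Y"
    and Sinv_S: "Sinv (S z) = z"
    and S_Sinv: "S (Sinv z) = z"
    and snd_Sinv: "snd (Sinv z) = T (snd z)"
    and digit_fst_Sinv: "dg (fst (Sinv z)) = dg (snd z)"
proof -
  have sz: "prod.swap z \<in> Y" using assms by (simp add: swap_Y)
  show "Sinv z \<in> Y" using S_Y[OF sz] by (simp add: Sinv_def swap_Y)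
  show "Sinv (S z) = z" using swap_S_involution[OF assms] by (simp add: Sinv_def)
  have "prod.swap (S (Sinv z)) = prod.swap z"
    using swap_S_involution[OF sz] by (simp add: Sinv_def)
  then show "S (Sinv z) = z" by (metis swap_swap)
  show "snd (Sinv z) = T (snd z)" by (simp add: Sinv_def fst_S)
  show "dg (fst (Sinv z)) = dg (snd z)" using digit_snd_S[OF sz] by (simp add: Sinv_def)
qed

lemma bij_S: "bij_betw S Y Y"
  by (rule bij_betwI[where g = Sinv]) (auto simp: S_Y Sinv_Y Sinv_S S_Sinv)

lemma inv_into_S: "z \<in> Y \<Longrightarrow> inv_into Y S z = Sinv z"
  using bij_S by (intro inv_into_f_eq) (auto simp: bij_betw_def Sinv_Y S_Sinv)

lemma Sinv_measurable [measurable]: "Sinv \<in> borel_measurable borel"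
proof -
  have "prod.swap \<in> borel_measurable (borel :: (real \<times> real) measure)"
    by (intro borel_measurable_continuous_onI) (auto simp: prod.swap_def intro!: continuous_intros)
  then show ?thesis unfolding Sinv_def[abs_def] using S_measurable by measurable
qed

lemma Y_in_sets_nu: "Y \<in> sets \<nu>"
  by (simp add: sets_nu_iff Y_subset_X)

lemma sets_restrict_nu_Y: "sets (restrict_space \<nu> Y) = sets (restrict_space borel Y)"
proof (rule set_eqI)
  fix A
  show "A \<in> sets (restrict_space \<nu> Y) \<longleftrightarrow> A \<in> sets (restrict_space borel Y)"
    using Y_in_sets_nu Y_subset_X
    by (subst (1 2) sets_restrict_space_iff) (auto simp: sets_nu_iff)
qed

lemma restrict_nu_Y_iff: "A \<in> sets (restrict_space \<nu> Y) \<longleftrightarrow> A \<in> sets borel \<and> A \<subseteq> Y"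
  unfolding sets_restrict_nu_Y by (subst sets_restrict_space_iff) auto

lemma emeasure_restrict_nu_Y: "A \<subseteq> Y \<Longrightarrow> emeasure (restrict_space \<nu> Y) A = emeasure \<nu> A"
  using Y_in_sets_nu Y_subset_X by (intro emeasure_restrict_space) (auto simp: Int_absorb2)

lemma measurable_restrict_Y:
  assumes [measurable]: "f \<in> borel_measurable borel" and "\<And>z. z \<in> Y \<Longrightarrow> f z \<in> Y"
  shows "f \<in> measurable (restrict_space \<nu> Y) (restrict_space \<nu> Y)"
  unfolding measurable_cong_sets[OF sets_restrict_nu_Y sets_restrict_nu_Y]
  by (rule measurable_restrict_space3) (use assms in auto)

lemma space_restrict_nu_Y: "space (restrict_space \<nu> Y) = Y"
  using Y_subset_X by (auto simp: space_restrict_space)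

lemma invertible_S: "invertible_system_on Y \<nu> S"
  unfolding invertible_system_on_def
proof (intro conjI)
  show "prob_space \<nu>" by (rule prob_space_nu)
  show "Y \<in> sets \<nu>" by (rule Y_in_sets_nu)
  show "emeasure \<nu> (space \<nu> - Y) = 0" by (simp add: nu_X_minus_Y)
  show "bij_betw S Y Y" by (rule bij_S)
  show S: "S \<in> measurable (restrict_space \<nu> Y) (restrict_space \<nu> Y)"
    by (rule measurable_restrict_Y) (auto simp: S_Y)
  have "Sinv \<in> measurable (restrict_space \<nu> Y) (restrict_space \<nu> Y)"
    by (rule measurable_restrict_Y) (auto simp: Sinv_Y)
  then show "inv_into Y S \<in> measurable (restrict_space \<nu> Y) (restrict_space \<nu> Y)"
    by (rule measurable_cong[THEN iffD1, rotated]) (simp add: space_restrict_nu_Y inv_into_S)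
  show "distr (restrict_space \<nu> Y) (restrict_space \<nu> Y) S = restrict_space \<nu> Y"
  proof (rule measure_eqI)
    fix A assume "A \<in> sets (distr (restrict_space \<nu> Y) (restrict_space \<nu> Y) S)"
    then have A: "A \<in> sets (restrict_space \<nu> Y)" "A \<in> sets borel" "A \<subseteq> Y"
      by (auto simp: restrict_nu_Y_iff)
    have "emeasure (distr (restrict_space \<nu> Y) (restrict_space \<nu> Y) S) A = emeasure \<nu> (S -` A \<inter> Y)"
      using emeasure_distr[OF S A(1)] by (simp add: space_restrict_nu_Y emeasure_restrict_nu_Y)
    also have "\<dots> = emeasure \<nu> A"
      using emeasure_nu_S_vimage[OF A(2)] A(3) by (simp add: Int_absorb2)
    finally show "emeasure (distr (restrict_space \<nu> Y) (restrict_space \<nu> Y) S) A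
        = emeasure (restrict_space \<nu> Y) A"
      using A(3) by (simp add: emeasure_restrict_nu_Y)
  qed simp
qed

text \<open>Taken as a marginal instead of through a density: invariance is then inherited from
  \<open>S\<close>, and equality with \<open>mu_T\<close> comes from uniqueness.\<close>

definition \<mu>\<^sub>0 :: "real measure" where
  "\<mu>\<^sub>0 = distr \<nu> (restrict_space borel Om) fst"

lemma Om_borel [measurable]: "Om \<in> sets borel"
  unfolding Omega_def by measurable

lemma sets_mu0: "sets \<mu>\<^sub>0 = sets (restrict_space borel Om)"
  by (simp add: \<mu>\<^sub>0_def)

lemma space_mu0 [simp]: "space \<mu>\<^sub>0 = Om"
  by (simp add: \<mu>\<^sub>0_def space_restrict_space)

lemma sets_Om_iff: "B \<in> sets (restrict_space borel Om) \<longleftrightarrow> B \<in> sets borel \<and> B \<subseteq> Om"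
  by (subst sets_restrict_space_iff) auto

lemma fst_measurable_nu: "fst \<in> measurable \<nu> (restrict_space borel Om)"
proof -
  have "fst \<in> measurable (restrict_space borel X) (restrict_space borel Om)"
  proof (rule measurable_restrict_space3)
    show "fst \<in> borel_measurable (borel :: (real \<times> real) measure)"
      unfolding borel_prod[symmetric] by (rule measurable_fst)
    show "fst \<in> X \<rightarrow> Om" by (auto simp: X_eq Omega_def)
  qed
  then show ?thesis using measurable_cong_sets[OF sets_nu refl] by blast
qed

lemma fst_vimage_borel: "B \<in> sets borel \<Longrightarrow> fst -` B \<in> sets (borel :: (real \<times> real) measure)"
  using measurable_sets[of fst borel borel B] borel_prod measurable_fst
  by (metis Int_UNIV_right space_borel)

lemma emeasure_mu0:
  assumes "B \<in> sets borel" "B \<subseteq> Om"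
  shows "emeasure \<mu>\<^sub>0 B = emeasure \<nu> (fst -` B \<inter> Y)"
proof -
  have "emeasure \<mu>\<^sub>0 B = emeasure \<nu> (fst -` B \<inter> X)"
    unfolding \<mu>\<^sub>0_def using assms by (subst emeasure_distr[OF fst_measurable_nu]) (auto simp: sets_Om_iff)
  then show ?thesis using emeasure_nu_Int_Y[OF fst_vimage_borel[OF assms(1)]] by simp
qed

lemma prob_space_mu0: "prob_space \<mu>\<^sub>0"
  unfolding \<mu>\<^sub>0_def by (rule prob_space.prob_space_distr[OF prob_space_nu fst_measurable_nu])

lemma T_Om: "x \<in> Om \<Longrightarrow> T x \<in> Om"
proof -
  assume x: "x \<in> Om"
  have a: "adj a1 a2" "adj a2 a1" by (auto simp: adj_def)
  show ?thesis
  proof (cases "x = 0")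
    \<comment> \<open>Here \<open>T x = 0 = x\<close>, so the value lies in \<open>Om\<close>
      because \<open>x\<close> does.\<close>
    case True then show ?thesis using x by (simp add: cf_map_def)
  next
    case False then show ?thesis using x T_in[OF a(1)] T_in[OF a(2)] by (auto simp: Omega_def)
  qed
qed

lemma T_measurable_Om: "T \<in> measurable (restrict_space borel Om) (restrict_space borel Om)"
  by (rule measurable_restrict_space3) (auto simp: T_Om)

lemma T_vimage_Om: "B \<in> sets borel \<Longrightarrow> T -` B \<inter> Om \<in> sets borel"
  using measurable_sets[OF T_measurable, of B] by auto

text \<open>The first projection intertwines \<open>S\<close> and \<open>T\<close>, so preimages
  under \<open>T\<close> lift to preimages under \<open>S\<close> and the invariance descends to the
  marginal.\<close>

lemma mps_mu0: "measure_preserving_system \<mu>\<^sub>0 T"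
  unfolding measure_preserving_system_def
proof (intro conjI)
  show T: "T \<in> measurable \<mu>\<^sub>0 \<mu>\<^sub>0"
    using T_measurable_Om measurable_cong_sets[OF sets_mu0 sets_mu0] by blast
  show "distr \<mu>\<^sub>0 \<mu>\<^sub>0 T = \<mu>\<^sub>0"
  proof (rule measure_eqI)
    fix B assume "B \<in> sets (distr \<mu>\<^sub>0 \<mu>\<^sub>0 T)"
    then have B: "B \<in> sets \<mu>\<^sub>0" "B \<in> sets borel" "B \<subseteq> Om" by (auto simp: sets_mu0 sets_Om_iff)
    have "emeasure (distr \<mu>\<^sub>0 \<mu>\<^sub>0 T) B = emeasure \<mu>\<^sub>0 (T -` B \<inter> Om)"
      using emeasure_distr[OF T B(1)] by simp
    also have "\<dots> = emeasure \<nu> (fst -` (T -` B \<inter> Om) \<inter> Y)"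
      by (rule emeasure_mu0) (use B T_vimage_Om in auto)
    also have "fst -` (T -` B \<inter> Om) \<inter> Y = S -` (fst -` B) \<inter> Y"
      using Y_subset_X by (auto simp: S_Pair X_eq Omega_def)
    also have "emeasure \<nu> \<dots> = emeasure \<nu> (fst -` B \<inter> Y)"
      by (rule emeasure_nu_S_vimage[OF fst_vimage_borel[OF B(2)]])
    also have "\<dots> = emeasure \<mu>\<^sub>0 B" using emeasure_mu0 B by simp
    finally show "emeasure (distr \<mu>\<^sub>0 \<mu>\<^sub>0 T) B = emeasure \<mu>\<^sub>0 B" .
  qed simp
qed (rule prob_space_mu0)

text \<open>The kernel is positive on \<open>X\<close>, so a null set of the marginal has a planar
  Lebesgue null set above it. Fibres have length \<open>1\<close>, hence the base is null as well.
  This lets Lebesgue arguments serve for \<open>\<mu>\<^sub>0\<close>.\<close>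

lemma null_mu0_iff:
  assumes "B \<in> sets borel" "B \<subseteq> Om"
  shows "emeasure \<mu>\<^sub>0 B = 0 \<longleftrightarrow> emeasure lborel B = 0"
proof
  assume B0: "emeasure lborel B = 0"
  have "emeasure lborel (B \<times> (UNIV :: real set)) = emeasure lborel B * emeasure lborel (UNIV :: real set)"
    unfolding lborel_prod[symmetric] by (rule lborel.emeasure_pair_measure_Times) (use assms in auto)
  then have "B \<times> UNIV \<in> null_sets (lborel :: (real \<times> real) measure)"
    using assms B0 by (auto simp: null_sets_def intro!: Times_borel)
  then have "AE z in lborel. z \<notin> B \<times> (UNIV :: real set)" by (rule AE_not_in)
  then have "(\<integral>\<^sup>+z. ennreal (ker z) * indicator (fst -` B \<inter> Y) z \<partial>lborel) = (\<integral>\<^sup>+z. 0 \<partial>(lborel :: (real \<times> real) measure))"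
    by (intro nn_integral_cong_AE) (auto elim!: eventually_mono simp: indicator_def)
  then show "emeasure \<mu>\<^sub>0 B = 0"
    using assms Y_subset_X fst_vimage_borel[OF assms(1)] by (simp add: emeasure_mu0 emeasure_nu le_infI2)
next
  assume "emeasure \<mu>\<^sub>0 B = 0"
  define A where "A = fst -` B \<inter> X"
  have A[measurable]: "A \<in> sets borel" using fst_vimage_borel[OF assms(1)] by (simp add: A_def)
  have "emeasure \<nu> A = 0"
    using \<open>emeasure \<mu>\<^sub>0 B = 0\<close> assms emeasure_nu_Int_Y[OF fst_vimage_borel[OF assms(1)]]
    by (simp add: emeasure_mu0 A_def)
  then have "(\<integral>\<^sup>+z. ennreal (ker z) * indicator A z \<partial>lborel) = 0"
    using emeasure_nu[OF A] C_pos by (auto simp: A_def)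
  then have "AE z in lborel. ennreal (ker z) * indicator A z = 0"
    by (subst (asm) nn_integral_0_iff_AE) auto
  moreover have "ker z > 0" if "z \<in> A" for z
  proof -
    have "fst z \<ge> 0" "snd z \<ge> 0" using that
      by (auto simp: A_def X_eq unit_ival_def intro: order_trans[OF of_nat_0_le_iff])
    then have "real N + fst z * snd z > 0" using N_pos by (simp add: add_pos_nonneg)
    then show ?thesis using N_pos by (cases z) (simp add: ext_kernel_def)
  qed
  ultimately have "AE z in lborel. z \<notin> A"
    by (elim eventually_mono) (force simp: indicator_def split: if_splits)
  then have A0: "A \<in> null_sets lborel" by (subst AE_iff_null_sets) auto
  \<comment> \<open>\<open>A\<close> is a product only over each interval separately, because the
    fibre changes with the interval.\<close>
  have "emeasure lborel (B \<inter> unit_ival a) = 0" if ab: "adj a b" for a b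
  proof -
    have "(B \<inter> unit_ival a) \<times> {real b..real b + 1} \<subseteq> A"
      using ab by (auto simp: A_def X_eq adj_def)
    then have "(B \<inter> unit_ival a) \<times> {real b..real b + 1} \<in> null_sets lborel"
      by (rule null_sets_subset[OF A0, rotated]) (use assms in \<open>auto intro!: Times_borel\<close>)
    moreover have "emeasure lborel ((B \<inter> unit_ival a) \<times> {real b..real b + 1})
       = emeasure lborel (B \<inter> unit_ival a) * emeasure lborel {real b..real b + 1}"
      unfolding lborel_prod[symmetric] by (rule lborel.emeasure_pair_measure_Times) (use assms in auto)
    ultimately show ?thesis by (auto simp: null_sets_def)
  qed
  then have "B \<inter> unit_ival a1 \<union> B \<inter> unit_ival a2 \<in> null_sets lborel"
    using assms by (intro null_sets.Un) (auto simp: null_sets_def adj_def)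
  moreover have "B \<inter> unit_ival a1 \<union> B \<inter> unit_ival a2 = B" using assms by (auto simp: Omega_def)
  ultimately show "emeasure lborel B = 0" by auto
qed

section \<open>Cylinders\<close>

definition ZZ :: "real set" where "ZZ = Z a1 \<union> Z a2"

text \<open>The Boolean separates the two intervals already at length \<open>0\<close>. Codes form a
  countable type, so unions of cylinders of one length are measurable.\<close>

definition code :: "nat \<Rightarrow> real \<Rightarrow> bool \<times> int list" where
  "code n x = (x \<in> Z a1, map (\<lambda>i. dg ((T ^^ i) x)) [0..<n])"

definition cyl :: "nat \<Rightarrow> bool \<times> int list \<Rightarrow> real set" where
  "cyl n c = {x \<in> ZZ. code n x = c}"

lemma adj_exists: "adj a1 a2" "adj a2 a1"
  by (auto simp: adj_def)

lemma ZZ_cases: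
  assumes "x \<in> ZZ"
  obtains a b where "adj a b" "x \<in> Z a"
  using assms adj_exists by (auto simp: ZZ_def)

lemma Z_subset_ZZ: "adj a b \<Longrightarrow> Z a \<subseteq> ZZ"
  by (auto simp: ZZ_def adj_def)

lemma T_ZZ: "x \<in> ZZ \<Longrightarrow> T x \<in> ZZ"
  by (metis T_Z(1) Z_subset_ZZ ZZ_cases adj_sym subsetD)

lemma ZZ_borel [measurable]: "ZZ \<in> sets borel"
  unfolding ZZ_def by measurable

lemma funpow_T_measurable [measurable]: "T ^^ n \<in> borel_measurable borel"
proof (induction n)
  case (Suc n)
  show ?case unfolding funpow_Suc_right by (rule measurable_comp[OF T_measurable Suc])
qed (simp add: id_def)

lemma code_eq_iff:
  "code n x = code n x' \<longleftrightarrow> (x \<in> Z a1 \<longleftrightarrow> x' \<in> Z a1) \<and> (\<forall>i<n. dg ((T ^^ i) x) = dg ((T ^^ i) x'))"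
  by (auto simp: code_def)

lemma code_same_side:
  assumes "x \<in> ZZ" "x' \<in> ZZ" "code n x = code n x'" "adj a b" "x \<in> Z a"
  shows "x' \<in> Z a"
  using assms Z_disjoint by (auto simp: code_eq_iff ZZ_def adj_def)

lemma cyl_borel [measurable]: "cyl n c \<in> sets borel"
proof -
  have "cyl n c = ZZ \<inter> {x. (x \<in> Z a1) = fst c} \<inter>
      {x. length (snd c) = n \<and> (\<forall>i\<in>{..<n}. dg ((T ^^ i) x) = snd c ! i)}"
    by (cases c) (auto simp: cyl_def code_def list_eq_iff_nth_eq)
  also have "\<dots> \<in> sets borel"
  proof -
    have "{x. (x \<in> Z a1) = fst c} = (if fst c then Z a1 else - Z a1)" by auto
    moreover have "{x. length (snd c) = n \<and> (\<forall>i\<in>{..<n}. dg ((T ^^ i) x) = snd c ! i)} \<in> sets borel"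
    proof -
      have "{x \<in> space borel. length (snd c) = n \<and> (\<forall>i\<in>{..<n}. dg ((T ^^ i) x) = snd c ! i)} \<in> sets borel"
        by measurable
      then show ?thesis by simp
    qed
    ultimately show ?thesis by auto
  qed
  finally show ?thesis .
qed

section \<open>Contraction and approximation of open sets by cylinders\<close>

definition \<theta> :: real where
  "\<theta> = (real (a1 + a2) + 1) / (real (a1 + a2) + 2)"

lemma theta_bounds: "0 \<le> \<theta>" "\<theta> < 1"
  by (simp_all add: \<theta>_def)

lemma mult_T_eq:
  assumes "adj a b" "x \<in> Z a"
  shows "x * T x = real N - x * real_of_int (dg x)"
  unfolding T_eq[OF assms(1) Z_D(1,3)[OF assms(2)]] using Z_D(3)[OF assms(2)]
  by (simp add: right_diff_distrib)

text \<open>With \<open>m = a1 + a2\<close> one has \<open>x T x \<le> (m + 1) x\<close> and, as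
  digits are at least \<open>1\<close>, also \<open>x T x \<le> N - x\<close>. Adding the first to
  \<open>m + 1\<close> times the second eliminates \<open>x\<close>; this balance is where
  \<open>\<theta>\<close> comes from.\<close>

lemma mult_T_le:
  assumes "adj a b" "x \<in> Z a"
  shows "0 < x * T x" "x * T x \<le> \<theta> * real N"
proof -
  note x = Z_D[OF assms(2)] and Tx = Z_D[OF T_Z(1)[OF assms]]
  show "0 < x * T x" using x Tx by simp
  define m where "m = real (a1 + a2)"
  have "T x \<le> m + 1" using Tx(5) assms(1) by (auto simp: m_def adj_def)
  then have 1: "x * T x \<le> x * (m + 1)" using x by (intro mult_left_mono) auto
  have "real_of_int (dg x) \<ge> 1" using digit_pos[OF assms(1) x(1,3)] by simp
  then have "x * 1 \<le> x * real_of_int (dg x)" using x by (intro mult_left_mono) auto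
  then have "x * T x \<le> real N - x" using mult_T_eq[OF assms] by simp
  then have "(m + 1) * (x * T x) \<le> (m + 1) * (real N - x)" by (intro mult_left_mono) (auto simp: m_def)
  with 1 have "(m + 2) * (x * T x) \<le> (m + 1) * real N" by (simp add: algebra_simps)
  then show "x * T x \<le> \<theta> * real N" by (simp add: \<theta>_def m_def[symmetric] field_simps m_def)
qed

text \<open>Multiplying \<open>x T x = N - d x\<close> by \<open>x'\<close>, its primed version by
  \<open>x\<close>, and subtracting eliminates the common digit.\<close>

lemma dist_eq_dist_T:
  assumes "adj a b" "x \<in> Z a" "x' \<in> Z a" "dg x = dg x'"
  shows "\<bar>x - x'\<bar> * real N = \<bar>T x - T x'\<bar> * (x * x')"
proof -
  note x = Z_D[OF assms(2)] and x' = Z_D[OF assms(3)]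
  have eq: "x * T x = real N - x * real_of_int (dg x)" "x' * T x' = real N - x' * real_of_int (dg x)"
    using mult_T_eq[OF assms(1,2)] mult_T_eq[OF assms(1,3)] assms(4) by simp_all
  have "(T x' - T x) * (x * x') = x * (x' * T x') - x' * (x * T x)" by (simp add: algebra_simps)
  also have "\<dots> = (x - x') * real N" unfolding eq by (simp add: algebra_simps)
  finally have "(T x' - T x) * (x * x') = (x - x') * real N" .
  then have "\<bar>(T x' - T x) * (x * x')\<bar> = \<bar>(x - x') * real N\<bar>" by simp
  then show ?thesis using x x' by (simp add: abs_mult abs_minus_commute)
qed

text \<open>Steps are taken in pairs. A single step contributes the factor \<open>x x' / N\<close>,
  which may exceed \<open>1\<close>; over two steps the factors regroup into \<open>x T x\<close>
  and \<open>x' T x'\<close>, each at most \<open>\<theta> N\<close>.\<close>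

lemma contraction:
  assumes "adj a b" "x \<in> Z a" "x' \<in> Z a" "\<forall>i < 2 * n. dg ((T ^^ i) x) = dg ((T ^^ i) x')"
  shows "\<bar>x - x'\<bar> \<le> (\<theta>\<^sup>2) ^ n"
  using assms(2-)
proof (induction n arbitrary: x x')
  case 0
  then show ?case using Z_D(4,5)[of x a] Z_D(4,5)[of x' a] by simp
next
  case (Suc n)
  have d0: "dg x = dg x'" using Suc.prems(3)[rule_format, of 0] by simp
  have d1: "dg (T x) = dg (T x')" using Suc.prems(3)[rule_format, of 1] by simp
  have dn: "dg ((T ^^ i) (T (T x))) = dg ((T ^^ i) (T (T x')))" if "i < 2 * n" for i
    using Suc.prems(3)[rule_format, of "Suc (Suc i)"] that by (simp add: funpow_swap1)
  note Tx = T_Z(1)[OF assms(1) Suc.prems(1)] and Tx' = T_Z(1)[OF assms(1) Suc.prems(2)]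
  note b = adj_sym[OF assms(1)]
  have IH: "\<bar>T (T x) - T (T x')\<bar> \<le> (\<theta>\<^sup>2) ^ n"
    using T_Z(1)[OF b Tx] T_Z(1)[OF b Tx'] dn by (intro Suc.IH) auto
  have "(\<bar>x - x'\<bar> * real N) * real N = (\<bar>T x - T x'\<bar> * real N) * (x * x')"
    using dist_eq_dist_T[OF assms(1) Suc.prems(1,2) d0] by simp
  also have "\<dots> = \<bar>T (T x) - T (T x')\<bar> * ((x * T x) * (x' * T x'))"
    unfolding dist_eq_dist_T[OF b Tx Tx' d1] by simp
  also have "\<dots> \<le> (\<theta>\<^sup>2) ^ n * ((\<theta> * real N) * (\<theta> * real N))"
    using mult_T_le[OF assms(1) Suc.prems(1)] mult_T_le[OF assms(1) Suc.prems(2)] theta_bounds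
    by (intro mult_mono[OF IH] mult_mono[of "x * T x" _ "x' * T x'"]) auto
  also have "\<dots> = ((\<theta>\<^sup>2) ^ Suc n * real N) * real N"
    by (simp add: power2_eq_square)
  finally show ?case using N_pos by simp
qed

lemma code_mono: "n \<le> m \<Longrightarrow> code m x = code m x' \<Longrightarrow> code n x = code n x'"
  by (auto simp: code_eq_iff)

lemma cylinder_subset_open:
  assumes "open U" "x \<in> U" "x \<in> ZZ"
  shows "\<exists>n. cyl n (code n x) \<subseteq> U"
proof -
  obtain e where e: "e > 0" "ball x e \<subseteq> U" using assms(1,2) openE by blast
  obtain a b where ab: "adj a b" "x \<in> Z a" using assms(3) by (rule ZZ_cases)
  have "\<theta>\<^sup>2 < 1" using theta_bounds by (simp add: power_less_one_iff)
  then obtain n where n: "(\<theta>\<^sup>2) ^ n < e" using real_arch_pow_inv[of e "\<theta>\<^sup>2"] e(1) by auto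
  have "cyl (2 * n) (code (2 * n) x) \<subseteq> U"
  proof
    fix x' assume "x' \<in> cyl (2 * n) (code (2 * n) x)"
    then have x': "x' \<in> ZZ" "code (2 * n) x = code (2 * n) x'" by (auto simp: cyl_def)
    have "\<bar>x - x'\<bar> \<le> (\<theta>\<^sup>2) ^ n"
      using code_same_side[OF assms(3) x' ab] x'(2) by (intro contraction[OF ab]) (auto simp: code_eq_iff)
    then show "x' \<in> U" using n e(2) by (auto simp: dist_real_def subset_iff)
  qed
  then show ?thesis by blast
qed

text \<open>Cylinders of one fixed length are disjoint, so countable additivity applies at each
  stage; for open \<open>U\<close> the stages increase to \<open>U \<inter> ZZ\<close>.\<close>

definition cyl_hull :: "real set \<Rightarrow> nat \<Rightarrow> real set" where
  "cyl_hull U n = (\<Union>c\<in>{c. cyl n c \<subseteq> U}. cyl n c)"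

lemma cyl_hull_Un: "open U \<Longrightarrow> (\<Union>n. cyl_hull U n) = U \<inter> ZZ"
proof (intro equalityI subsetI)
  fix x assume "x \<in> (\<Union>n. cyl_hull U n)"
  then show "x \<in> U \<inter> ZZ" by (auto simp: cyl_hull_def cyl_def)
next
  fix x assume "open U" "x \<in> U \<inter> ZZ"
  then obtain n where "cyl n (code n x) \<subseteq> U" using cylinder_subset_open by blast
  moreover have "x \<in> cyl n (code n x)" using \<open>x \<in> U \<inter> ZZ\<close> by (auto simp: cyl_def)
  ultimately show "x \<in> (\<Union>n. cyl_hull U n)" unfolding cyl_hull_def by blast
qed

lemma incseq_cyl_hull: "incseq (cyl_hull U)"
proof (rule monoI)
  fix n m :: nat assume nm: "n \<le> m"
  show "cyl_hull U n \<subseteq> cyl_hull U m"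
  proof
    fix x assume "x \<in> cyl_hull U n"
    then have x: "x \<in> ZZ" "cyl n (code n x) \<subseteq> U" by (auto simp: cyl_hull_def cyl_def)
    have "cyl m (code m x) \<subseteq> cyl n (code n x)" unfolding cyl_def using code_mono[OF nm] by blast
    then have "cyl m (code m x) \<subseteq> U" using x by blast
    moreover have "x \<in> cyl m (code m x)" using x by (auto simp: cyl_def)
    ultimately show "x \<in> cyl_hull U m" unfolding cyl_hull_def by blast
  qed
qed

lemma cyl_hull_borel [measurable]: "cyl_hull U n \<in> sets borel"
  unfolding cyl_hull_def by (intro sets.countable_UN'') auto

lemma disjoint_cyl: "disjoint_family_on (cyl n) I"
  by (auto simp: disjoint_family_on_def cyl_def)

text \<open>Integral form of the fact that, up to null sets, \<open>T ^^ n\<close> maps a cylinder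
  onto an interval with a Moebius inverse, whose derivative has absolute value
  \<open>K / (c y + d)\<^sup>2\<close>. The inequality \<open>c \<le> d\<close> is carried through
  the induction because it controls the distortion.\<close>

lemma cyl_density:
  assumes x0: "x0 \<in> ZZ"
  shows "\<exists>a b K c d. adj a b \<and> (\<forall>x \<in> cyl n (code n x0). (T ^^ n) x \<in> Z a) \<and> 0 < K \<and> 0 \<le> c \<and> c \<le> d \<and> 0 < d \<and>
    (\<forall>B\<in>sets borel. emeasure lborel (cyl n (code n x0) \<inter> (T ^^ n) -` B)
      = (\<integral>\<^sup>+y. ennreal (K / (c * y + d)\<^sup>2) * indicator (B \<inter> Z a) y \<partial>lborel))"
proof (induction n)
  case 0
  obtain a b where ab: "adj a b" "x0 \<in> Z a" using x0 by (rule ZZ_cases)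
  have eq: "cyl 0 (code 0 x0) = Z a"
    using ab Z_disjoint by (auto simp: cyl_def code_def ZZ_def adj_def)
  show ?case
  proof (rule exI[of _ a], rule exI[of _ b], rule exI[of _ 1], rule exI[of _ 0], rule exI[of _ 1], intro conjI ballI)
    show "adj a b" by fact
    show "(T ^^ 0) x \<in> Z a" if "x \<in> cyl 0 (code 0 x0)" for x using that by (simp add: eq)
    fix B :: "real set" assume [measurable]: "B \<in> sets borel"
    show "emeasure lborel (cyl 0 (code 0 x0) \<inter> (T ^^ 0) -` B)
      = (\<integral>\<^sup>+y. ennreal (1 / (0 * y + 1)\<^sup>2) * indicator (B \<inter> Z a) y \<partial>lborel)"
      by (simp add: eq Int_commute)
  qed simp_all
next
  case (Suc n)
  then obtain a b K c d where ab: "adj a b" and Z: "\<And>x. x \<in> cyl n (code n x0) \<Longrightarrow> (T ^^ n) x \<in> Z a"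
    and K: "0 < K" "0 \<le> c" "c \<le> d" "0 < d"
    and dens: "\<And>B. B \<in> sets borel \<Longrightarrow> emeasure lborel (cyl n (code n x0) \<inter> (T ^^ n) -` B)
      = (\<integral>\<^sup>+y. ennreal (K / (c * y + d)\<^sup>2) * indicator (B \<inter> Z a) y \<partial>lborel)"
    by (elim exE conjE) (rule that, assumption, blast, assumption+, blast)
  define y0 where "y0 = (T ^^ n) x0"
  have y0: "y0 \<in> Z a" using Z[of x0] x0 by (simp add: y0_def cyl_def)
  define k where "k = real_of_int (dg y0)"
  have k1: "k \<ge> 1" using digit_pos[OF ab Z_D(1,3)[OF y0]] by (simp add: k_def)
  define J where "J = {y \<in> Z a. dg y = dg y0}"
  have [measurable]: "J \<in> sets borel"
  proof -
    have "{y \<in> space borel. y \<in> Z a \<and> dg y = dg y0} \<in> sets borel" by measurable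
    then show ?thesis by (simp add: J_def)
  qed
  have cylSuc: "cyl (Suc n) (code (Suc n) x0) = cyl n (code n x0) \<inter> (T ^^ n) -` J"
    using Z by (auto simp: cyl_def code_eq_iff J_def y0_def less_Suc_eq)
  show ?case
  \<comment> \<open>Substituting \<open>y = N / (k + u)\<close> in \<open>c y + d\<close> and
    clearing the denominator gives \<open>d u + (c N + k d)\<close>. So \<open>d\<close> takes the
    place of \<open>c\<close>, and the new pair is ordered again because
    \<open>k \<ge> 1\<close>.\<close>
  proof (rule exI[of _ b], rule exI[of _ a], rule exI[of _ "K * real N"], rule exI[of _ d],
      rule exI[of _ "c * real N + k * d"], intro conjI ballI)
    show "adj b a" using ab by (rule adj_sym)
    show "(T ^^ Suc n) x \<in> Z b" if "x \<in> cyl (Suc n) (code (Suc n) x0)" for x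
      using that Z[of x] T_Z(1)[OF ab] unfolding cylSuc by simp
    show "0 < K * real N" using K N_pos by simp
    have "0 \<le> c * real N" "d \<le> k * d" using K k1 mult_right_mono[of 1 k d] by auto
    then show "0 \<le> d" "d \<le> c * real N + k * d" "0 < c * real N + k * d" using K by linarith+
    fix B :: "real set" assume [measurable]: "B \<in> sets borel"
    have TB: "T -` B \<in> sets borel"
      using measurable_sets[OF T_measurable, of B] by simp
    have "emeasure lborel (cyl (Suc n) (code (Suc n) x0) \<inter> (T ^^ Suc n) -` B)
      = emeasure lborel (cyl n (code n x0) \<inter> (T ^^ n) -` (J \<inter> T -` B))"
      unfolding cylSuc by (rule arg_cong[of _ _ "emeasure lborel"]) auto
    also have "\<dots> = (\<integral>\<^sup>+y. ennreal (K / (c * y + d)\<^sup>2) * indicator (J \<inter> T -` B \<inter> Z a) y \<partial>lborel)"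
      using TB by (intro dens) auto
    also have "\<dots> = (\<integral>\<^sup>+y. (ennreal (K / (c * y + d)\<^sup>2) * indicator B (T y))
        * indicator {y \<in> Z a. dg y = dg y0} y \<partial>lborel)"
      by (intro nn_integral_cong) (auto simp: indicator_def J_def)
    also have "\<dots> = (\<integral>\<^sup>+u. (ennreal (K / (c * (real N / (of_int (dg y0) + u)) + d)\<^sup>2)
          * indicator B (T (real N / (of_int (dg y0) + u))))
        * ennreal (real N / (of_int (dg y0) + u)\<^sup>2) * indicator (Z b) u \<partial>lborel)"
      by (rule nn_integral_branch[OF ab y0]) measurable
    also have "\<dots> = (\<integral>\<^sup>+u. ennreal (K * real N / (d * u + (c * real N + k * d))\<^sup>2) * indicator (B \<inter> Z b) u \<partial>lborel)"
    proof (rule nn_integral_cong)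
      fix u :: real
      show "(ennreal (K / (c * (real N / (of_int (dg y0) + u)) + d)\<^sup>2)
          * indicator B (T (real N / (of_int (dg y0) + u))))
        * ennreal (real N / (of_int (dg y0) + u)\<^sup>2) * indicator (Z b) u
        = ennreal (K * real N / (d * u + (c * real N + k * d))\<^sup>2) * indicator (B \<inter> Z b) u"
      proof (cases "u \<in> Z b")
        case u: True
        have pos: "k + u > 0" using k1 Z_D(6)[OF u] by simp
        have "K / (c * (real N / (k + u)) + d)\<^sup>2 * (real N / (k + u)\<^sup>2) = K * real N / ((c * (real N / (k + u)) + d) * (k + u))\<^sup>2"
          by (simp add: power_mult_distrib)
        also have "(c * (real N / (k + u)) + d) * (k + u) = d * u + (c * real N + k * d)"
          using pos by (simp add: field_simps)
        finally have "ennreal (K / (c * (real N / (k + u)) + d)\<^sup>2) * ennreal (real N / (k + u)\<^sup>2)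
          = ennreal (K * real N / (d * u + (c * real N + k * d))\<^sup>2)"
          using K by (subst ennreal_mult[symmetric]) auto
        then show ?thesis
          using inverse_branch(3)[OF ab y0 u] u by (auto simp: k_def indicator_def)
      qed simp
    qed
    finally show "emeasure lborel (cyl (Suc n) (code (Suc n) x0) \<inter> (T ^^ Suc n) -` B)
      = (\<integral>\<^sup>+u. ennreal (K * real N / (d * u + (c * real N + k * d))\<^sup>2) * indicator (B \<inter> Z b) u \<partial>lborel)" .
  qed
qed

section \<open>Ergodicity\<close>

lemma funpow_T_ZZ: "x \<in> ZZ \<Longrightarrow> (T ^^ n) x \<in> ZZ"
  by (induction n) (auto simp: T_ZZ)

text \<open>Bounded distortion: on an interval of length \<open>1\<close> the value
  \<open>p y + q\<close> stays between \<open>r\<close> and \<open>2 r\<close> since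
  \<open>p \<le> q\<close>, so the density varies by a factor of at most \<open>4\<close>. The bound
  \<open>e\<close> must serve both intervals, as \<open>T ^^ n\<close> may carry the cylinder to
  either.\<close>

lemma cyl_lower_bound:
  assumes E[measurable]: "E \<in> sets borel" and inv: "\<And>x. x \<in> ZZ \<Longrightarrow> T x \<in> E \<longleftrightarrow> x \<in> E"
    and e: "\<And>a b. adj a b \<Longrightarrow> e \<le> emeasure lborel (E \<inter> Z a)"
  shows "ennreal (1/4) * e * emeasure lborel (cyl n c) \<le> emeasure lborel (E \<inter> cyl n c)"
proof (cases "cyl n c = {}")
  case False
  then obtain x0 where x0: "x0 \<in> ZZ" "c = code n x0" by (auto simp: cyl_def)
  from cyl_density[OF x0(1), of n] obtain a b K p q where
    ab: "adj a b" and Z: "\<forall>x \<in> cyl n (code n x0). (T ^^ n) x \<in> Z a"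
    and K: "0 < K" "0 \<le> p" "p \<le> q" "0 < q"
    and dens: "\<forall>B\<in>sets borel. emeasure lborel (cyl n (code n x0) \<inter> (T ^^ n) -` B)
      = (\<integral>\<^sup>+y. ennreal (K / (p * y + q)\<^sup>2) * indicator (B \<inter> Z a) y \<partial>lborel)"
    by (elim exE conjE)
  have Tn: "(T ^^ m) x \<in> E \<longleftrightarrow> x \<in> E" if "x \<in> ZZ" for x m
    by (induction m) (use that funpow_T_ZZ inv in auto)
  have EC: "E \<inter> cyl n c = cyl n (code n x0) \<inter> (T ^^ n) -` E"
    using Tn by (auto simp: x0 cyl_def)
  define r where "r = p * real a + q"
  have r: "r > 0" using K by (simp add: r_def add_nonneg_pos)
  have "emeasure lborel (cyl n c) = (\<integral>\<^sup>+y. ennreal (K / (p * y + q)\<^sup>2) * indicator (Z a) y \<partial>lborel)"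
    using dens[rule_format, of UNIV] by (simp add: x0(2))
  also have "\<dots> \<le> (\<integral>\<^sup>+y. ennreal (K / r\<^sup>2) * indicator (unit_ival a) y \<partial>lborel)"
  proof (rule nn_integral_mono)
    fix y :: real
    have "K / (p * y + q)\<^sup>2 \<le> K / r\<^sup>2" if "y \<in> Z a"
    proof -
      have "r \<le> p * y + q" using Z_D(4)[OF that] K by (simp add: r_def mult_left_mono)
      then show ?thesis using r K by (intro divide_left_mono power_mono mult_pos_pos zero_less_power) auto
    qed
    then show "ennreal (K / (p * y + q)\<^sup>2) * indicator (Z a) y \<le> ennreal (K / r\<^sup>2) * indicator (unit_ival a) y"
      by (auto simp: indicator_def Z_D intro: ennreal_leI)
  qed
  also have "\<dots> = ennreal (K / r\<^sup>2)"
    by (simp add: nn_integral_cmult unit_ival_def)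
  finally have up: "emeasure lborel (cyl n c) \<le> ennreal (K / r\<^sup>2)" .
  have "ennreal (1/4) * e * emeasure lborel (cyl n c) \<le> ennreal (1/4) * e * ennreal (K / r\<^sup>2)"
    by (rule mult_left_mono[OF up]) simp
  also have "\<dots> = (ennreal (1/4) * ennreal (K / r\<^sup>2)) * e" by (simp only: ac_simps)
  also have "\<dots> = ennreal (K / (2 * r)\<^sup>2) * e"
    using K by (subst ennreal_mult[symmetric]) (auto simp: power_mult_distrib)
  also have "\<dots> \<le> ennreal (K / (2 * r)\<^sup>2) * emeasure lborel (E \<inter> Z a)"
    by (rule mult_left_mono[OF e[OF ab]]) simp
  also have "\<dots> = (\<integral>\<^sup>+y. ennreal (K / (2 * r)\<^sup>2) * indicator (E \<inter> Z a) y \<partial>lborel)"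
    by (simp add: nn_integral_cmult)
  also have "\<dots> \<le> (\<integral>\<^sup>+y. ennreal (K / (p * y + q)\<^sup>2) * indicator (E \<inter> Z a) y \<partial>lborel)"
  proof (rule nn_integral_mono)
    fix y :: real
    have "K / (2 * r)\<^sup>2 \<le> K / (p * y + q)\<^sup>2" if "y \<in> Z a"
    proof -
      have "p * y \<le> p * (real a + 1)" using Z_D(5)[OF that] K by (intro mult_left_mono) auto
      moreover have "0 \<le> p * real a" using K by simp
      ultimately have "p * y + q \<le> 2 * r" using K(3) by (simp add: r_def algebra_simps)
      moreover have "0 < p * y + q" using Z_D(6)[OF that] K by (simp add: add_nonneg_pos)
      ultimately show ?thesis using K by (intro divide_left_mono power_mono mult_pos_pos zero_less_power) auto
    qed
    then show "ennreal (K / (2 * r)\<^sup>2) * indicator (E \<inter> Z a) y \<le> ennreal (K / (p * y + q)\<^sup>2) * indicator (E \<inter> Z a) y"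
      by (auto simp: indicator_def intro: ennreal_leI)
  qed
  also have "\<dots> = emeasure lborel (E \<inter> cyl n c)" unfolding EC by (rule dens[rule_format, OF E, symmetric])
  finally show ?thesis .
qed simp

text \<open>The bound is summed over the disjoint cylinders of length \<open>n\<close> inside
  \<open>U\<close>, then continuity from below lets \<open>n\<close> grow.\<close>

lemma open_lower_bound:
  assumes E[measurable]: "E \<in> sets borel" and U: "open U"
    and bd: "\<And>n c. k * emeasure lborel (cyl n c) \<le> emeasure lborel (E \<inter> cyl n c)"
  shows "k * emeasure lborel (U \<inter> ZZ) \<le> emeasure lborel (E \<inter> (U \<inter> ZZ))"
proof -
  have hull: "k * emeasure lborel (cyl_hull U n) \<le> emeasure lborel (E \<inter> (U \<inter> ZZ))" for n
  proof -
    define D where "D = {c. cyl n c \<subseteq> U}"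
    have "k * emeasure lborel (cyl_hull U n) = k * (\<integral>\<^sup>+c. emeasure lborel (cyl n c) \<partial>count_space D)"
      unfolding cyl_hull_def D_def by (subst emeasure_UN_countable) (auto simp: disjoint_cyl)
    also have "\<dots> = (\<integral>\<^sup>+c. k * emeasure lborel (cyl n c) \<partial>count_space D)"
      by (rule nn_integral_cmult[symmetric]) simp
    also have "\<dots> \<le> (\<integral>\<^sup>+c. emeasure lborel (E \<inter> cyl n c) \<partial>count_space D)"
      by (rule nn_integral_mono) (rule bd)
    also have "\<dots> = emeasure lborel (\<Union>c\<in>D. E \<inter> cyl n c)"
    proof (rule emeasure_UN_countable[symmetric])
      show "disjoint_family_on (\<lambda>c. E \<inter> cyl n c) D" by (auto simp: disjoint_family_on_def cyl_def)
    qed auto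
    also have "\<dots> \<le> emeasure lborel (E \<inter> (U \<inter> ZZ))"
      by (rule emeasure_mono) (use U in \<open>auto simp: D_def cyl_def\<close>)
    finally show ?thesis .
  qed
  have range: "range (cyl_hull U) \<subseteq> sets lborel" by auto
  have "k * emeasure lborel (U \<inter> ZZ) = k * (SUP n. emeasure lborel (cyl_hull U n))"
    using SUP_emeasure_incseq[OF range incseq_cyl_hull] by (simp add: cyl_hull_Un[OF U])
  also have "\<dots> = (SUP n. k * emeasure lborel (cyl_hull U n))"
    by (rule SUP_mult_left_ennreal)
  also have "\<dots> \<le> emeasure lborel (E \<inter> (U \<inter> ZZ))"
    by (rule SUP_least) (rule hull)
  finally show ?thesis .
qed

lemma ZZ_subset_Om: "ZZ \<subseteq> Om"
  by (auto simp: ZZ_def Omega_def Z_D)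

lemma Om_minus_ZZ_null: "emeasure lborel (Om - ZZ) = 0"
proof -
  have "Om - ZZ \<subseteq> \<rat>" by (auto simp: ZZ_def Omega_def Z_def)
  then have "countable (Om - ZZ)" using countable_rat countable_subset by blast
  then show ?thesis by (rule emeasure_lborel_countable)
qed

text \<open>\<open>T\<close> sends \<open>E \<inter> Z b\<close> into \<open>E \<inter> Z a\<close>,
  so the invariance of \<open>\<mu>\<^sub>0\<close> carries nullity over. An invariant set that is
  not null thus has positive measure in both intervals, as the cylinder bound requires.\<close>

lemma invariant_half_null:
  assumes E[measurable]: "E \<in> sets borel" and inv: "\<And>x. x \<in> ZZ \<Longrightarrow> T x \<in> E \<longleftrightarrow> x \<in> E"
    and ab: "adj a b" and 0: "emeasure lborel (E \<inter> Z a) = 0"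
  shows "emeasure lborel (E \<inter> Z b) = 0"
proof -
  have ZO: "Z a \<subseteq> Om" "Z b \<subseteq> Om" using ab Z_subset_ZZ adj_sym ZZ_subset_Om by blast+
  have "emeasure \<mu>\<^sub>0 (E \<inter> Z a) = 0" using 0 ZO by (subst null_mu0_iff) auto
  moreover have m: "E \<inter> Z a \<in> sets \<mu>\<^sub>0" using ZO by (auto simp: sets_mu0 sets_Om_iff)
  ultimately have "emeasure \<mu>\<^sub>0 (T -` (E \<inter> Z a) \<inter> Om) = 0"
    using mps_mu0 emeasure_distr[of T \<mu>\<^sub>0 \<mu>\<^sub>0 "E \<inter> Z a"] by (simp add: measure_preserving_system_def)
  then have "emeasure lborel (T -` (E \<inter> Z a) \<inter> Om) = 0"
    using T_vimage_Om[of "E \<inter> Z a"] by (subst (asm) null_mu0_iff) auto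
  moreover have "E \<inter> Z b \<subseteq> T -` (E \<inter> Z a) \<inter> Om"
    using inv T_Z(1)[OF adj_sym[OF ab]] Z_subset_ZZ[OF adj_sym[OF ab]] ZO by auto
  ultimately show ?thesis
    using T_vimage_Om[of "E \<inter> Z a"] by (metis E Z_borel emeasure_eq_0 sets.Int sets_lborel)
qed

text \<open>Outer regularity takes the place of density points: an open \<open>U\<close> only
  slightly larger than \<open>ZZ - E\<close> contains little of \<open>E\<close>, whereas the
  cylinder bound makes \<open>E\<close> fill a fixed proportion of
  \<open>U \<inter> ZZ\<close>.\<close>

lemma zero_one:
  assumes E[measurable]: "E \<in> sets borel" and inv: "\<And>x. x \<in> ZZ \<Longrightarrow> T x \<in> E \<longleftrightarrow> x \<in> E"
  shows "emeasure lborel (E \<inter> ZZ) = 0 \<or> emeasure lborel (ZZ - E) = 0"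
proof (cases "emeasure lborel (E \<inter> Z a1) = 0 \<or> emeasure lborel (E \<inter> Z a2) = 0")
  case True
  then have "emeasure lborel (E \<inter> Z a1) = 0" "emeasure lborel (E \<inter> Z a2) = 0"
    using invariant_half_null[OF E inv adj_exists(1)] invariant_half_null[OF E inv adj_exists(2)] by blast+
  then have "(E \<inter> Z a1) \<union> (E \<inter> Z a2) \<in> null_sets lborel"
    by (intro null_sets.Un) (auto simp: null_sets_def)
  then have "E \<inter> ZZ \<in> null_sets lborel" by (simp add: ZZ_def Int_Un_distrib)
  then show ?thesis by auto
next
  case False
  define e where "e = min (emeasure lborel (E \<inter> Z a1)) (emeasure lborel (E \<inter> Z a2))"
  define k where "k = ennreal (1/4) * e"
  have "e \<noteq> 0" using False by (auto simp: e_def min_def)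
  then have k0: "k \<noteq> 0" by (simp add: k_def)
  have bd: "k * emeasure lborel (cyl n c) \<le> emeasure lborel (E \<inter> cyl n c)" for n c
    unfolding k_def by (rule cyl_lower_bound[OF E inv]) (auto simp: e_def adj_def)
  have le: "k * emeasure lborel (ZZ - E) \<le> 0 + ennreal \<epsilon>" if "\<epsilon> > 0" for \<epsilon>
  proof -
    obtain U where U: "open U" "ZZ - E \<subseteq> U" "emeasure lborel (U - (ZZ - E)) < ennreal \<epsilon>"
      using outer_regular_lborel[of "ZZ - E" \<epsilon>] \<open>\<epsilon> > 0\<close> by auto
    have [measurable]: "U \<in> sets borel" using U(1) by simp
    have "k * emeasure lborel (ZZ - E) \<le> k * emeasure lborel (U \<inter> ZZ)"
      using U(2) by (intro mult_left_mono emeasure_mono) auto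
    also have "\<dots> \<le> emeasure lborel (E \<inter> (U \<inter> ZZ))" by (rule open_lower_bound[OF E U(1) bd])
    also have "\<dots> \<le> emeasure lborel (U - (ZZ - E))" by (rule emeasure_mono) auto
    also have "\<dots> \<le> 0 + ennreal \<epsilon>" using U(3) by simp
    finally show ?thesis .
  qed
  have "k * emeasure lborel (ZZ - E) \<le> 0"
    by (rule ennreal_le_epsilon) (rule le)
  then have "emeasure lborel (ZZ - E) = 0" using k0 by simp
  then show ?thesis ..
qed

lemma ergodic_mu0: "ergodic_system \<mu>\<^sub>0 T"
  unfolding ergodic_system_def
proof (intro conjI ballI impI)
  show "measure_preserving_system \<mu>\<^sub>0 T" by (rule mps_mu0)
  fix A assume A: "A \<in> sets \<mu>\<^sub>0" "T -` A \<inter> space \<mu>\<^sub>0 = A"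
  then have Ab: "A \<in> sets borel" "A \<subseteq> Om" by (auto simp: sets_mu0 sets_Om_iff)
  have "emeasure lborel (A \<inter> ZZ) = 0 \<or> emeasure lborel (ZZ - A) = 0"
    using A(2) ZZ_subset_Om by (intro zero_one Ab) auto
  then have "emeasure lborel A = 0 \<or> emeasure lborel (Om - A) = 0"
  proof (elim disj_forward)
    assume "emeasure lborel (A \<inter> ZZ) = 0"
    then have "(A \<inter> ZZ) \<union> (Om - ZZ) \<in> null_sets lborel"
      using Om_minus_ZZ_null Ab by (intro null_sets.Un) (auto simp: null_sets_def)
    then have "A \<in> null_sets lborel" by (rule null_sets_subset) (use Ab in auto)
    then show "emeasure lborel A = 0" by auto
  next
    assume "emeasure lborel (ZZ - A) = 0"
    then have "(ZZ - A) \<union> (Om - ZZ) \<in> null_sets lborel"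
      using Om_minus_ZZ_null Ab by (intro null_sets.Un) (auto simp: null_sets_def)
    then have "Om - A \<in> null_sets lborel" by (rule null_sets_subset) (use Ab in auto)
    then show "emeasure lborel (Om - A) = 0" by auto
  qed
  then show "emeasure \<mu>\<^sub>0 A = 0 \<or> emeasure \<mu>\<^sub>0 (space \<mu>\<^sub>0 - A) = 0"
    using Ab null_mu0_iff[of A] null_mu0_iff[of "Om - A"] by auto
qed

lemma null_sets_restrict_Om:
  "B \<in> null_sets (restrict_space lborel Om) \<longleftrightarrow> B \<in> sets borel \<and> B \<subseteq> Om \<and> emeasure lborel B = 0"
proof -
  have "sets (restrict_space lborel Om) = sets (restrict_space borel Om)"
    by (rule sets_restrict_space_cong) simp
  then show ?thesis by (auto simp: null_sets_def sets_Om_iff emeasure_restrict_space)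
qed

lemma ergodic_acim_mu0: "ergodic_acim a1 a2 N \<mu>\<^sub>0"
  unfolding ergodic_acim_def absolutely_continuous_def
proof (intro conjI sets_mu0 ergodic_mu0 subsetI)
  fix B assume "B \<in> null_sets (restrict_space lborel Om)"
  then show "B \<in> null_sets \<mu>\<^sub>0"
    unfolding null_sets_restrict_Om by (auto simp: null_sets_def sets_mu0 sets_Om_iff null_mu0_iff)
qed

text \<open>Serves the uniqueness proof, whose superlevel set is invariant only almost everywhere,
  while \<open>zero_one\<close> asks for invariance at every point of \<open>ZZ\<close>.\<close>

lemma AE_zero_one:
  assumes E: "E \<in> sets \<mu>\<^sub>0" and inv: "AE x in \<mu>\<^sub>0. T x \<in> E \<longleftrightarrow> x \<in> E"
  shows "emeasure \<mu>\<^sub>0 E = 0 \<or> emeasure \<mu>\<^sub>0 (Om - E) = 0"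
proof -
  have Eb[measurable]: "E \<in> sets borel" and EO: "E \<subseteq> Om" using E by (auto simp: sets_mu0 sets_Om_iff)
  have T: "T \<in> measurable \<mu>\<^sub>0 \<mu>\<^sub>0" "distr \<mu>\<^sub>0 \<mu>\<^sub>0 T = \<mu>\<^sub>0"
    using mps_mu0 by (auto simp: measure_preserving_system_def)
  have inv_n: "AE x in \<mu>\<^sub>0. (T ^^ n) x \<in> E \<longleftrightarrow> x \<in> E" for n
  proof (induction n)
    case (Suc n)
    \<comment> \<open>The induction hypothesis is pulled back along \<open>T\<close>, which
      preserves \<open>\<mu>\<^sub>0\<close>.\<close>
    have "AE x in distr \<mu>\<^sub>0 \<mu>\<^sub>0 T. (T ^^ n) x \<in> E \<longleftrightarrow> x \<in> E" by (subst T(2)) (rule Suc)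
    then have "AE x in \<mu>\<^sub>0. (T ^^ n) (T x) \<in> E \<longleftrightarrow> T x \<in> E" by (rule AE_distrD[OF T(1)])
    then show ?case using inv by eventually_elim (simp add: funpow_swap1)
  qed simp
  \<comment> \<open>the limsup of the preimages of \<open>E\<close> is strictly invariant and agrees with \<open>E\<close> up to a null set\<close>
  define F where "F = {x \<in> ZZ. \<forall>m. \<exists>n\<ge>m. (T ^^ n) x \<in> E}"
  have Fb[measurable]: "F \<in> sets borel"
  proof -
    have "{x \<in> space borel. x \<in> ZZ \<and> (\<forall>m. \<exists>n. n \<ge> m \<and> (T ^^ n) x \<in> E)} \<in> sets borel"
      by measurable
    then show ?thesis by (simp add: F_def)
  qed
  have FO: "F \<subseteq> Om" using ZZ_subset_Om by (auto simp: F_def)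
  have Finv: "T x \<in> F \<longleftrightarrow> x \<in> F" if "x \<in> ZZ" for x
  proof -
    have "(\<forall>m. \<exists>n\<ge>m. (T ^^ n) (T x) \<in> E) \<longleftrightarrow> (\<forall>m. \<exists>n\<ge>m. (T ^^ n) x \<in> E)"
    proof (intro iffI allI)
      fix m assume "\<forall>m. \<exists>n\<ge>m. (T ^^ n) (T x) \<in> E"
      then obtain n where "n \<ge> m" "(T ^^ Suc n) x \<in> E" by (metis funpow_Suc_right comp_apply)
      then show "\<exists>n\<ge>m. (T ^^ n) x \<in> E" by (metis le_SucI)
    next
      fix m assume "\<forall>m. \<exists>n\<ge>m. (T ^^ n) x \<in> E"
      then obtain n where "n \<ge> Suc m" "(T ^^ n) x \<in> E" by blast
      then show "\<exists>n\<ge>m. (T ^^ n) (T x) \<in> E"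
        by (cases n) (auto simp del: funpow.simps simp: funpow_Suc_right)
    qed
    then show ?thesis using that T_ZZ by (simp add: F_def)
  qed
  have "emeasure \<mu>\<^sub>0 (Om - ZZ) = 0"
    using Om_minus_ZZ_null by (subst null_mu0_iff) auto
  then have "AE x in \<mu>\<^sub>0. x \<notin> Om - ZZ"
    by (intro AE_not_in) (auto simp: null_sets_def sets_mu0 sets_Om_iff)
  moreover have "AE x in \<mu>\<^sub>0. \<forall>n. (T ^^ n) x \<in> E \<longleftrightarrow> x \<in> E" using inv_n by (simp add: AE_all_countable)
  ultimately have EF: "AE x in \<mu>\<^sub>0. x \<in> F \<longleftrightarrow> x \<in> E"
    using AE_space[of \<mu>\<^sub>0] by eventually_elim (auto simp: F_def)
  have Fm: "F \<in> sets \<mu>\<^sub>0" "Om - F \<in> sets \<mu>\<^sub>0" "Om - E \<in> sets \<mu>\<^sub>0"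
    using FO EO by (auto simp: sets_mu0 sets_Om_iff)
  have "emeasure \<mu>\<^sub>0 F = emeasure \<mu>\<^sub>0 E"
    by (rule emeasure_eq_AE[OF EF Fm(1) E])
  moreover have "emeasure \<mu>\<^sub>0 (Om - F) = emeasure \<mu>\<^sub>0 (Om - E)"
    by (rule emeasure_eq_AE[OF _ Fm(2,3)]) (use EF in eventually_elim, auto)
  moreover have "emeasure lborel F = 0 \<or> emeasure lborel (Om - F) = 0"
  proof -
    have "emeasure lborel (F \<inter> ZZ) = 0 \<or> emeasure lborel (ZZ - F) = 0"
      by (rule zero_one[OF Fb]) (rule Finv)
    then show ?thesis
  proof (elim disj_forward)
    show "emeasure lborel F = 0" if "emeasure lborel (F \<inter> ZZ) = 0"
      using that by (simp add: F_def Int_def conj_commute cong: conj_cong)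
    assume "emeasure lborel (ZZ - F) = 0"
    then have "(ZZ - F) \<union> (Om - ZZ) \<in> null_sets lborel"
      using Om_minus_ZZ_null by (intro null_sets.Un) (auto simp: null_sets_def)
    then have "Om - F \<in> null_sets lborel" by (rule null_sets_subset) auto
    then show "emeasure lborel (Om - F) = 0" by auto
  qed
  qed
  ultimately show ?thesis
    using null_mu0_iff[of F] null_mu0_iff[of "Om - F"] FO by auto
qed

section \<open>Uniqueness and the generating family\<close>

text \<open>Let \<open>f\<close> be the density of \<open>\<mu>\<close> and \<open>E\<close> the set
  where \<open>f > 1\<close>. The sets \<open>E - E'\<close> and \<open>E' - E\<close> have equal
  mass for either measure, yet \<open>f > 1\<close> on the first and \<open>f \<le> 1\<close> on the
  second, so both are null for \<open>\<mu>\<^sub>0\<close>. By the zero-one law \<open>E\<close> is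
  null or full; full is impossible by total mass, and \<open>f \<le> 1\<close> with integral
  \<open>1\<close> forces \<open>f = 1\<close>.\<close>

lemma ergodic_acim_unique:
  assumes \<mu>: "ergodic_acim a1 a2 N \<mu>"
  shows "\<mu> = \<mu>\<^sub>0"
proof -
  have sets_eq: "sets \<mu> = sets \<mu>\<^sub>0" using \<mu> by (simp add: ergodic_acim_def sets_mu0)
  then have space_eq: "space \<mu> = Om" using sets_eq_imp_space_eq[OF sets_eq] by simp
  have mps: "measure_preserving_system \<mu> T" using \<mu> by (simp add: ergodic_acim_def ergodic_system_def)
  interpret M: prob_space \<mu>\<^sub>0 by (rule prob_space_mu0)
  interpret P: prob_space \<mu> using mps by (simp add: measure_preserving_system_def)
  have "absolutely_continuous \<mu>\<^sub>0 \<mu>"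
    unfolding absolutely_continuous_def
  proof
    fix B assume "B \<in> null_sets \<mu>\<^sub>0"
    then have "B \<in> null_sets (restrict_space lborel Om)"
      unfolding null_sets_restrict_Om by (auto simp: null_sets_def sets_mu0 sets_Om_iff null_mu0_iff)
    then show "B \<in> null_sets \<mu>" using \<mu> by (auto simp: ergodic_acim_def absolutely_continuous_def)
  qed
  then obtain f where f[measurable]: "f \<in> borel_measurable \<mu>\<^sub>0" and dens: "density \<mu>\<^sub>0 f = \<mu>"
    using M.Radon_Nikodym sets_eq by blast
  have em: "emeasure \<mu> A = (\<integral>\<^sup>+x. f x * indicator A x \<partial>\<mu>\<^sub>0)" if "A \<in> sets \<mu>\<^sub>0" for A
    unfolding dens[symmetric] using that by (simp add: emeasure_density)
  have T: "T \<in> measurable \<mu>\<^sub>0 \<mu>\<^sub>0" "distr \<mu>\<^sub>0 \<mu>\<^sub>0 T = \<mu>\<^sub>0"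
    using mps_mu0 by (auto simp: measure_preserving_system_def)
  have T': "T \<in> measurable \<mu> \<mu>" "distr \<mu> \<mu> T = \<mu>"
    using mps by (auto simp: measure_preserving_system_def)
  define E where "E = {x \<in> space \<mu>\<^sub>0. 1 < f x}"
  define E' where "E' = T -` E \<inter> Om"
  have E[measurable]: "E \<in> sets \<mu>\<^sub>0" unfolding E_def by measurable
  have E'[measurable]: "E' \<in> sets \<mu>\<^sub>0" using measurable_sets[OF T(1) E] by (simp add: E'_def)
  have \<mu>0E: "emeasure \<mu>\<^sub>0 E' = emeasure \<mu>\<^sub>0 E"
    using emeasure_distr[OF T(1) E] T(2) by (simp add: E'_def)
  have \<mu>E: "emeasure \<mu> E' = emeasure \<mu> E"
    using emeasure_distr[OF T'(1), of E] T'(2) E sets_eq by (simp add: E'_def space_eq)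
  have diff0: "emeasure \<mu>\<^sub>0 (E - E') = emeasure \<mu>\<^sub>0 (E' - E)"
  proof -
    have "emeasure \<mu>\<^sub>0 E = emeasure \<mu>\<^sub>0 (E \<inter> E') + emeasure \<mu>\<^sub>0 (E - E')"
         "emeasure \<mu>\<^sub>0 E' = emeasure \<mu>\<^sub>0 (E \<inter> E') + emeasure \<mu>\<^sub>0 (E' - E)"
      by (subst plus_emeasure; auto intro!: arg_cong[of _ _ "emeasure \<mu>\<^sub>0"])+
    then show ?thesis using \<mu>0E M.emeasure_finite[of "E \<inter> E'"] by (simp add: ennreal_add_left_cancel)
  qed
  have diff: "emeasure \<mu> (E - E') = emeasure \<mu> (E' - E)"
  proof -
    have "emeasure \<mu> E = emeasure \<mu> (E \<inter> E') + emeasure \<mu> (E - E')"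
         "emeasure \<mu> E' = emeasure \<mu> (E \<inter> E') + emeasure \<mu> (E' - E)"
      by (subst plus_emeasure; auto simp: sets_eq intro!: arg_cong[of _ _ "emeasure \<mu>"])+
    then show ?thesis using \<mu>E P.emeasure_finite[of "E \<inter> E'"] by (simp add: ennreal_add_left_cancel)
  qed
  \<comment> \<open>Where \<open>1 \<le> f\<close>, truncated subtraction of extended reals loses
    nothing.\<close>
  have excess: "emeasure \<mu> A = emeasure \<mu>\<^sub>0 A + (\<integral>\<^sup>+x. (f x - 1) * indicator A x \<partial>\<mu>\<^sub>0)"
    if [measurable]: "A \<in> sets \<mu>\<^sub>0" and "AE x in \<mu>\<^sub>0. x \<in> A \<longrightarrow> 1 \<le> f x" for A
  proof -
    have "emeasure \<mu> A = (\<integral>\<^sup>+x. indicator A x + (f x - 1) * indicator A x \<partial>\<mu>\<^sub>0)"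
      unfolding em[OF that(1)] using that(2)
      by (intro nn_integral_cong_AE) (auto elim!: eventually_mono simp: indicator_def add_diff_inverse_ennreal)
    then show ?thesis by (subst (asm) nn_integral_add) auto
  qed
  \<comment> \<open>On a subset of \<open>E\<close> the density exceeds \<open>1\<close>, so
    \<open>\<mu>\<close> strictly outweighs \<open>\<mu>\<^sub>0\<close> there unless the set is
    null.\<close>
  have null_excess: "emeasure \<mu>\<^sub>0 A = 0"
    if A[measurable]: "A \<in> sets \<mu>\<^sub>0" and AE: "A \<subseteq> E" and le: "emeasure \<mu> A \<le> emeasure \<mu>\<^sub>0 A" for A
  proof -
    have "emeasure \<mu>\<^sub>0 A + (\<integral>\<^sup>+x. (f x - 1) * indicator A x \<partial>\<mu>\<^sub>0) \<le> emeasure \<mu>\<^sub>0 A + 0"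
      using le excess[OF A] AE by (auto simp: E_def subset_iff less_imp_le)
    then have "(\<integral>\<^sup>+x. (f x - 1) * indicator A x \<partial>\<mu>\<^sub>0) = 0"
      using M.emeasure_finite[of A] by (subst (asm) ennreal_add_left_cancel_le) (auto simp: top_unique)
    then have "AE x in \<mu>\<^sub>0. (f x - 1) * indicator A x = 0"
      by (subst (asm) nn_integral_0_iff_AE) auto
    then have "AE x in \<mu>\<^sub>0. x \<notin> A"
    proof eventually_elim
      fix x assume "(f x - 1) * indicator A x = 0"
      then show "x \<notin> A" using AE by (auto simp: E_def indicator_def split: if_splits dest!: ennreal_minus_eq_0 subsetD)
    qed
    then show ?thesis using A by (subst (asm) AE_iff_null_sets[symmetric]) auto
  qed
  \<comment> \<open>Off \<open>E\<close> the density is at most \<open>1\<close>. By the two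
    equalities of masses the inequality passes to \<open>E - E'\<close>, where
    \<open>null_excess\<close> applies.\<close>
  have "emeasure \<mu> (E' - E) \<le> emeasure \<mu>\<^sub>0 (E' - E)"
  proof -
    have "emeasure \<mu> (E' - E) \<le> (\<integral>\<^sup>+x. indicator (E' - E) x \<partial>\<mu>\<^sub>0)"
      unfolding em[OF sets.Diff[OF E' E]]
      by (intro nn_integral_mono) (auto simp: indicator_def E_def E'_def)
    then show ?thesis by simp
  qed
  then have "emeasure \<mu>\<^sub>0 (E - E') = 0"
    using diff diff0 by (intro null_excess) auto
  then have "E - E' \<union> (E' - E) \<in> null_sets \<mu>\<^sub>0" using diff0 by (intro null_sets.Un) (auto simp: null_sets_def)
  then have "AE x in \<mu>\<^sub>0. x \<notin> E - E' \<union> (E' - E)" by (rule AE_not_in)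
  then have "AE x in \<mu>\<^sub>0. T x \<in> E \<longleftrightarrow> x \<in> E"
    using AE_space[of \<mu>\<^sub>0] by eventually_elim (auto simp: E'_def)
  from AE_zero_one[OF E this] have E0: "emeasure \<mu>\<^sub>0 E = 0"
  proof
    assume "emeasure \<mu>\<^sub>0 (Om - E) = 0"
    then have "AE x in \<mu>\<^sub>0. x \<notin> Om - E"
      using sets.compl_sets[OF E] by (intro AE_not_in) (simp add: null_sets_def)
    then have fE: "AE x in \<mu>\<^sub>0. x \<in> E" using AE_space[of \<mu>\<^sub>0] by eventually_elim auto
    have "emeasure \<mu>\<^sub>0 E = 1" using fE E by (intro M.emeasure_eq_1_AE)
    moreover have "emeasure \<mu> E \<le> 1" by (rule P.emeasure_le_1)
    ultimately show ?thesis by (intro null_excess[OF E]) auto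
  qed simp
  have le1: "AE x in \<mu>\<^sub>0. f x \<le> 1"
  proof -
    have "E \<in> null_sets \<mu>\<^sub>0" using E0 E by (simp add: null_sets_def)
    from AE_not_in[OF this] AE_space[of \<mu>\<^sub>0] show ?thesis by eventually_elim (auto simp: E_def)
  qed
  have "(\<integral>\<^sup>+x. f x \<partial>\<mu>\<^sub>0) = emeasure \<mu> Om"
    unfolding em[of Om, OF sets.top[of \<mu>\<^sub>0, simplified]] by (intro nn_integral_cong) (auto simp: indicator_def)
  then have If: "(\<integral>\<^sup>+x. f x \<partial>\<mu>\<^sub>0) = 1" using P.emeasure_space_1 by (simp add: space_eq)
  \<comment> \<open>Both measures have mass \<open>1\<close>, so the deficit \<open>1 - f\<close>
    has integral \<open>0\<close>.\<close>
  have "(\<integral>\<^sup>+x. 1 \<partial>\<mu>\<^sub>0) = (\<integral>\<^sup>+x. f x + (1 - f x) \<partial>\<mu>\<^sub>0)"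
    using le1 by (intro nn_integral_cong_AE) (auto elim!: eventually_mono simp: add_diff_inverse_ennreal)
  also have "\<dots> = 1 + (\<integral>\<^sup>+x. 1 - f x \<partial>\<mu>\<^sub>0)" by (simp add: nn_integral_add If)
  finally have "1 + (\<integral>\<^sup>+x. 1 - f x \<partial>\<mu>\<^sub>0) = 1 + 0"
    using M.emeasure_space_1 by simp
  then have "(\<integral>\<^sup>+x. 1 - f x \<partial>\<mu>\<^sub>0) = 0"
    by (subst (asm) ennreal_add_left_cancel) auto
  then have "AE x in \<mu>\<^sub>0. 1 - f x = 0" by (subst (asm) nn_integral_0_iff_AE) auto
  then have "AE x in \<mu>\<^sub>0. f x = 1"
    using le1 by eventually_elim (auto dest: ennreal_minus_eq_0 intro: antisym)
  then have "density \<mu>\<^sub>0 f = density \<mu>\<^sub>0 (\<lambda>_. 1)"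
    by (intro density_cong) auto
  then show ?thesis using dens by (simp add: density_1)
qed

lemma ex1_ergodic_acim: "\<exists>!\<mu>. ergodic_acim a1 a2 N \<mu>"
  using ergodic_acim_mu0 ergodic_acim_unique by blast

lemma mu_T_eq: "mu_T a1 a2 N = \<mu>\<^sub>0"
  unfolding mu_T_def using ergodic_acim_mu0 ergodic_acim_unique by (rule the_equality)

section \<open>Backward orbits and the generated sigma-algebra\<close>

lemma Sinv_funpow_Y: "z \<in> Y \<Longrightarrow> (Sinv ^^ i) z \<in> Y"
  by (induction i) (auto simp: Sinv_Y)

lemma S_funpow_Y: "z \<in> Y \<Longrightarrow> (S ^^ i) z \<in> Y"
  by (induction i) (auto simp: S_Y)

lemma S_funpow_Sinv: "z \<in> Y \<Longrightarrow> (S ^^ i) ((Sinv ^^ i) z) = z"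
proof (induction i arbitrary: z)
  case (Suc i)
  have "(S ^^ Suc i) ((Sinv ^^ Suc i) z) = S ((S ^^ i) ((Sinv ^^ i) (Sinv z)))"
    by (simp add: funpow_swap1)
  then show ?case using Suc.IH[OF Sinv_Y[OF Suc.prems]] S_Sinv[OF Suc.prems] by simp
qed simp

lemma Sinv_funpow_S: "z \<in> Y \<Longrightarrow> (Sinv ^^ i) ((S ^^ i) z) = z"
proof (induction i arbitrary: z)
  case (Suc i)
  have "(Sinv ^^ Suc i) ((S ^^ Suc i) z) = Sinv ((Sinv ^^ i) ((S ^^ i) (S z)))"
    by (simp add: funpow_swap1)
  then show ?case using Suc.IH[OF S_Y[OF Suc.prems]] Sinv_S[OF Suc.prems] by simp
qed simp

text \<open>Turns the forward images in the join into preimages under explicit backward iterates,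
  whose measurability is accessible.\<close>

lemma S_funpow_image:
  assumes "A \<subseteq> Y"
  shows "(S ^^ i) ` A = {z \<in> Y. (Sinv ^^ i) z \<in> A}"
proof (intro equalityI subsetI)
  fix z assume "z \<in> (S ^^ i) ` A"
  then show "z \<in> {z \<in> Y. (Sinv ^^ i) z \<in> A}"
    using assms by (auto simp: S_funpow_Y Sinv_funpow_S subset_iff)
next
  fix z assume "z \<in> {z \<in> Y. (Sinv ^^ i) z \<in> A}"
  then show "z \<in> (S ^^ i) ` A" using S_funpow_Sinv[of z i] by (intro image_eqI[of _ _ "(Sinv ^^ i) z"]) auto
qed

lemma snd_Sinv_funpow: "z \<in> Y \<Longrightarrow> snd ((Sinv ^^ i) z) = (T ^^ i) (snd z)"
  by (induction i) (auto simp: snd_Sinv Sinv_funpow_Y)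

text \<open>The join packaged as a measure space, so that functions can be called measurable with
  respect to it.\<close>

definition join_algebra :: "(real \<times> real) measure" where
  "join_algebra = sigma Y (\<Union>i::nat. {(S ^^ i) ` (fst -` B \<inter> Y) | B. B \<in> sets \<mu>\<^sub>0})"

lemma space_join [simp]: "space join_algebra = Y"
  and sets_join: "sets join_algebra = forward_join Y S fst \<mu>\<^sub>0"
proof -
  have "(\<Union>i::nat. {(S ^^ i) ` (fst -` B \<inter> Y) | B. B \<in> sets \<mu>\<^sub>0}) \<subseteq> Pow Y"
    using S_funpow_Y by auto
  then show "space join_algebra = Y" "sets join_algebra = forward_join Y S fst \<mu>\<^sub>0"
    by (simp_all add: join_algebra_def forward_join_def)
qed

lemma join_generator:
  assumes "B \<in> sets borel"
  shows "{z \<in> Y. fst ((Sinv ^^ i) z) \<in> B} \<in> sets join_algebra"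
proof -
  have B: "B \<inter> Om \<in> sets \<mu>\<^sub>0" using assms by (auto simp: sets_mu0 sets_Om_iff)
  have "fst z \<in> Om" if "z \<in> Y" for z using that Y_subset_X by (auto simp: X_eq Omega_def)
  then have "{z \<in> Y. fst ((Sinv ^^ i) z) \<in> B} = {z \<in> Y. (Sinv ^^ i) z \<in> fst -` (B \<inter> Om) \<inter> Y}"
    using Sinv_funpow_Y[of _ i] by blast
  also have "\<dots> = (S ^^ i) ` (fst -` (B \<inter> Om) \<inter> Y)" by (rule S_funpow_image[symmetric]) auto
  also have "\<dots> \<in> sets join_algebra" unfolding sets_join forward_join_def using B by (intro sigma_sets.Basic) blast
  finally show ?thesis .
qed

lemma fst_measurable_join [measurable]: "fst \<in> borel_measurable join_algebra"
proof (rule measurableI)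
  fix B :: "real set" assume "B \<in> sets borel"
  from join_generator[OF this, of 0] show "fst -` B \<inter> space join_algebra \<in> sets join_algebra"
    by (simp add: Collect_conj_eq Int_commute vimage_def)
qed simp

lemma snd_cyl_in_join: "{z \<in> Y. snd z \<in> cyl n c} \<in> sets join_algebra"
proof -
  \<comment> \<open>the digits of \<open>snd z\<close> are the first digits of \<open>fst\<close> along the backward orbit of \<open>z\<close>\<close>
  have dig: "dg ((T ^^ i) (snd z)) = dg (fst ((Sinv ^^ Suc i) z))" if "z \<in> Y" for i z
    using digit_fst_Sinv[OF Sinv_funpow_Y[OF that, of i]] snd_Sinv_funpow[OF that, of i] by simp
  \<comment> \<open>The two coordinates of a point of \<open>Y\<close> lie in different intervals,
    so the Boolean in the code of \<open>snd z\<close> is determined by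
    \<open>fst z\<close>.\<close>
  have side: "snd z \<in> Z a1 \<longleftrightarrow> fst z \<notin> Z a1" "snd z \<in> ZZ" if "z \<in> Y" for z
    using that Z_disjoint by (auto simp: Y_def ZZ_def)
  have mem: "snd z \<in> cyl n c \<longleftrightarrow> (fst z \<notin> Z a1) = fst c \<and>
      length (snd c) = n \<and> (\<forall>i\<in>{..<n}. dg (fst ((Sinv ^^ Suc i) z)) = snd c ! i)" if "z \<in> Y" for z
    unfolding dig[OF that, symmetric] cyl_def code_def using side[OF that]
    by (cases c) (auto simp: list_eq_iff_nth_eq)
  have "{z \<in> Y. snd z \<in> cyl n c} = {z \<in> Y. (fst z \<notin> Z a1) = fst c} \<inter>
      {z \<in> Y. length (snd c) = n \<and> (\<forall>i\<in>{..<n}. fst ((Sinv ^^ Suc i) z) \<in> {x. dg x = snd c ! i})}"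
    using mem by blast
  also have "\<dots> \<in> sets join_algebra"
  proof (intro sets.Int)
    have "{z \<in> space join_algebra. (fst z \<notin> Z a1) = fst c} \<in> sets join_algebra" by measurable
    then show "{z \<in> Y. (fst z \<notin> Z a1) = fst c} \<in> sets join_algebra" by simp
    have "{z \<in> space join_algebra. fst ((Sinv ^^ Suc i) z) \<in> {x. dg x = k}} \<in> sets join_algebra" for i k
    proof -
      have "{x \<in> space borel. dg x = k} \<in> sets borel" by measurable
      then show ?thesis using join_generator[of "{x. dg x = k}" "Suc i"] by (simp del: funpow.simps)
    qed
    then have "{z \<in> space join_algebra. \<forall>i\<in>{..<n}. fst ((Sinv ^^ Suc i) z) \<in> {x. dg x = snd c ! i}} \<in> sets join_algebra"
      by (intro sets.sets_Collect_finite_All) auto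
    then show "{z \<in> Y. length (snd c) = n \<and> (\<forall>i\<in>{..<n}. fst ((Sinv ^^ Suc i) z) \<in> {x. dg x = snd c ! i})} \<in> sets join_algebra"
      by (cases "length (snd c) = n") (simp_all del: funpow.simps)
  qed
  finally show ?thesis .
qed

text \<open>On \<open>Y\<close> the second coordinate lies in \<open>ZZ\<close>, where an open set
  is a countable union of cylinders.\<close>

lemma snd_measurable_join [measurable]: "snd \<in> borel_measurable join_algebra"
proof (rule borel_measurableI)
  fix U :: "real set" assume U: "open U"
  have "snd z \<in> ZZ" if "z \<in> Y" for z using that by (auto simp: Y_def ZZ_def)
  then have "snd -` U \<inter> space join_algebra = {z \<in> Y. snd z \<in> U \<inter> ZZ}" by auto
  also have "\<dots> = (\<Union>n. \<Union>c\<in>{c. cyl n c \<subseteq> U}. {z \<in> Y. snd z \<in> cyl n c})"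
    unfolding cyl_hull_Un[OF U, symmetric] cyl_hull_def by blast
  also have "\<dots> \<in> sets join_algebra"
    by (intro sets.countable_UN'' snd_cyl_in_join) auto
  finally show "snd -` U \<inter> space join_algebra \<in> sets join_algebra" .
qed

text \<open>Both coordinates are measurable for the join, hence so is the inclusion of
  \<open>Y\<close> into the plane.\<close>

lemma join_eq: "A \<in> sets borel \<Longrightarrow> A \<inter> Y \<in> sets join_algebra"
proof -
  assume A: "A \<in> sets borel"
  have "(\<lambda>z. (fst z, snd z)) \<in> measurable join_algebra (borel \<Otimes>\<^sub>M borel)" by measurable
  then have "(\<lambda>z. z) \<in> measurable join_algebra (borel :: (real \<times> real) measure)" by (simp add: borel_prod)
  from measurable_sets[OF this A] show ?thesis by simp
qed

lemma forward_join_subset: "forward_join Y S fst \<mu>\<^sub>0 \<subseteq> sets \<nu>"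
proof -
  have "(\<Union>i::nat. {(S ^^ i) ` (fst -` B \<inter> Y) | B. B \<in> sets \<mu>\<^sub>0}) \<subseteq> sets (restrict_space \<nu> Y)"
  proof safe
    fix i B assume "B \<in> sets \<mu>\<^sub>0"
    then have B: "B \<in> sets borel" by (auto simp: sets_mu0 sets_Om_iff)
    have "Sinv ^^ i \<in> borel_measurable borel"
    proof (induction i)
      case (Suc i)
      show ?case unfolding funpow_Suc_right by (rule measurable_comp[OF Sinv_measurable Suc])
    qed (simp add: id_def)
    from measurable_sets[OF this fst_vimage_borel[OF B]]
    have "(Sinv ^^ i) -` (fst -` B) \<inter> Y \<in> sets borel" by auto
    moreover have "(S ^^ i) ` (fst -` B \<inter> Y) = (Sinv ^^ i) -` (fst -` B) \<inter> Y"
      using Sinv_funpow_Y by (subst S_funpow_image) auto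
    ultimately show "(S ^^ i) ` (fst -` B \<inter> Y) \<in> sets (restrict_space \<nu> Y)"
      by (simp add: restrict_nu_Y_iff)
  qed
  from sets.sigma_sets_subset[OF this]
  have "forward_join Y S fst \<mu>\<^sub>0 \<subseteq> sets (restrict_space \<nu> Y)"
    by (simp add: forward_join_def space_restrict_nu_Y)
  then show ?thesis using Y_subset_X unfolding subset_iff restrict_nu_Y_iff sets_nu_iff by blast
qed

text \<open>Sets of the join lie inside \<open>Y\<close>. A Borel set is therefore matched by its
  trace on \<open>Y\<close>, with an error inside the null set \<open>X - Y\<close>; the other
  direction is exact.\<close>

lemma equal_mod_null_join: "equal_mod_null \<nu> (sets \<nu>) (forward_join Y S fst \<mu>\<^sub>0)"
  unfolding equal_mod_null_def
proof (intro conjI ballI)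
  fix A assume A: "A \<in> sets \<nu>"
  show "\<exists>B\<in>forward_join Y S fst \<mu>\<^sub>0. A - B \<union> (B - A) \<in> null_sets \<nu>"
  proof
    show "A \<inter> Y \<in> forward_join Y S fst \<mu>\<^sub>0"
      using join_eq A by (simp add: sets_join sets_nu_iff)
    have "X - Y \<in> null_sets \<nu>" by (auto simp: null_sets_def nu_X_minus_Y sets_nu_iff)
    then show "A - A \<inter> Y \<union> (A \<inter> Y - A) \<in> null_sets \<nu>"
      by (rule null_sets_subset) (use A in \<open>auto simp: sets_nu_iff\<close>)
  qed
next
  fix B assume "B \<in> forward_join Y S fst \<mu>\<^sub>0"
  then show "\<exists>A\<in>sets \<nu>. A - B \<union> (B - A) \<in> null_sets \<nu>"
    using forward_join_subset by (intro bexI[of _ B]) auto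
qed

lemma natural_extension_nu: "natural_extension fst \<nu> S \<mu>\<^sub>0 T"
  unfolding natural_extension_def
proof (intro conjI)
  show "fst \<in> measurable \<nu> \<mu>\<^sub>0"
    using fst_measurable_nu measurable_cong_sets[OF refl sets_mu0] by blast
  show "distr \<nu> \<mu>\<^sub>0 fst = \<mu>\<^sub>0"
    unfolding \<mu>\<^sub>0_def by (rule distr_cong) simp_all
  show "\<exists>Y. invertible_system_on Y \<nu> S \<and> equal_mod_null \<nu> (sets \<nu>) (forward_join Y S fst \<mu>\<^sub>0)"
    using invertible_S equal_mod_null_join by blast
qed (simp_all add: mps_mu0 fst_S)

end

theorem theorem4p1:
  fixes a1 a2 N :: nat
  assumes "a1 \<noteq> a2"
    and "simple_pair a1 a2 N"
  shows "(\<exists>!\<mu>. ergodic_acim a1 a2 N \<mu>) \<and>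
    natural_extension fst (ext_measure a1 a2 N) (ext_map a1 a2 N) (mu_T a1 a2 N) (cf_map a1 a2 N) \<and>
    (\<forall>A \<in> sets (restrict_space borel (ext_dom a1 a2)).
       measure (ext_measure a1 a2 N) A
         = norm_const a1 a2 N * set_lebesgue_integral lborel A (ext_kernel N)) \<and>
    inverse (norm_const a1 a2 N) = set_lebesgue_integral lborel (ext_dom a1 a2) (ext_kernel N) \<and>
    set_lebesgue_integral lborel (ext_dom a1 a2) (ext_kernel N)
      = 2 * ln (1 + real N / ((real N + real a1 * (real a2 + 1)) * (real N + real a2 * (real a1 + 1))))"
proof -
  interpret simple_cf a1 a2 N by unfold_locales fact+
  show ?thesis
  proof (intro conjI ballI)
    \<comment> \<open>Uniqueness identifies the measure described by \<open>THE\<close> with the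
      marginal \<open>\<mu>\<^sub>0\<close>.\<close>
    show "natural_extension fst \<nu> S (mu_T a1 a2 N) T" unfolding mu_T_eq by (rule natural_extension_nu)
    show "inverse C = set_lebesgue_integral lborel X ker" by (simp add: norm_const_def)
  qed (simp_all add: ex1_ergodic_acim measure_nu integral_ker_X[unfolded block_mass_def])
qed

end
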